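(* Let $n\ge 2$ be a fixed integer. Uniformly over $f\in\mathbb{Q}[X]$, as $H\to\infty$, \[ \#\mathcal{P}_n(\mathbb{Q};H,f) \ll \begin{cases} H^{2+o(1)}, & \text{if } n=2,\\ H^{n^2+o(1)}, & \text{if } n\ge 3.\end{cases} \]
   Context: For a real $H\ge 1$, let $\mathcal{F}(H)=\{a/b:\ a,b\in\mathbb{Z},\ 0\le |a|,b\le H,\ \gcd(a,b)=1\}$. Let $\mathcal{M}_n(\mathbb{Q};H)$ be the set of $n\times n$ matrices with all entries in $\mathcal{F}(H)$, and for $f\in\mathbb{Q}[X]$ let $\mathcal{P}_n(\mathbb{Q};H,f)$ be the set of $A\in\mathcal{M}_n(\mathbb{Q};H)$ whose characteristic polynomial is $f$. A bound $X\le H^{c+o(1)}$ uniformly over $f$ means: for every $\varepsilon>0$ there is $H_0$ (depending only on $\varepsilon,n$) with $X\le H^{c+\varepsilon}$ for all $H\ge H_0$ and all $f$; implied constants in $\ll$ depend only on $n$. *)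

theory Defs
  imports Complex_Main "Jordan_Normal_Form.Char_Poly"
begin

text \<open>The denominator is taken to be positive: \<open>b = 0\<close> does not give a rational number.\<close>

definition farey_rats :: "real \<Rightarrow> rat set" where
  "farey_rats H =
     {of_int a / of_int b | a b :: int.
        0 < b \<and> \<bar>real_of_int a\<bar> \<le> H \<and> real_of_int b \<le> H \<and> coprime a b}"

definition rat_mats :: "nat \<Rightarrow> real \<Rightarrow> rat mat set" where
  "rat_mats n H =
     {A \<in> carrier_mat n n. \<forall>i<n. \<forall>j<n. A $$ (i, j) \<in> farey_rats H}"

definition rat_mats_char_poly :: "nat \<Rightarrow> real \<Rightarrow> rat poly \<Rightarrow> rat mat set" where
  "rat_mats_char_poly n H f = {A \<in> rat_mats n H. char_poly A = f}"

end

theory Submission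
  imports Defs "Jordan_Normal_Form.Schur_Decomposition" "HOL-Computational_Algebra.Squarefree"
    "HOL-Library.FuncSet"
begin

text \<open>
  A matrix with prescribed characteristic polynomial has prescribed \<open>tr A\<close> and \<open>tr A\<^sup>2\<close>, that is,
  \<open>\<Sum> a\<^sub>i\<^sub>i\<close> is fixed and, given the diagonal, so is the bilinear sum \<open>\<Sum> a\<^sub>i\<^sub>j a\<^sub>j\<^sub>i\<close> over \<open>i < j\<close>.
  Each of these two equations already saves half of the parameters it involves. To see this,
  bound the indicator of \<open>x = 0\<close> by the weight \<open>1 / den x\<close>. This weight is nearly invariant under
  convolution with the fractions of height at most \<open>h\<close>, each convolution costing only a factor
  \<open>h\<close> (up to divisor functions), although there are about \<open>h\<^sup>2\<close> such fractions. A product \<open>x y\<close> of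
  two fractions of height \<open>H\<close> is, after cancelling two gcds \<open>e, f\<close>, a fraction of height at most
  \<open>H\<^sup>2 / (e f)\<close>, so a convolution with products costs \<open>\<Sum> H\<^sup>2 / (e f)\<close>, about \<open>H\<^sup>2\<close>. In total this
  gives \<open>n + 2 (n choose 2) = n\<^sup>2\<close> powers of \<open>H\<close>.

  For \<open>n = 2\<close> the off-diagonal entries have product \<open>a (t - a) - c\<close>, and one needs in addition
  that this quadratic polynomial takes values of height at most \<open>h\<close> for only about \<open>h\<close> fractions \<open>a\<close>.
\<close>

section \<open>The divisor bound\<close>

lemma card_divisors_prime_power_mult:
  fixes p m :: nat
  assumes "prime p" "m > 0"
  shows "card {d. d dvd p ^ a * m} \<le> (a + 1) * card {d. d dvd m}"
proof -
  have "{d. d dvd p ^ a * m} \<subseteq> (\<lambda>(i, d). p ^ i * d) ` ({..a} \<times> {d. d dvd m})"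
  proof
    fix d assume "d \<in> {d. d dvd p ^ a * m}"
    then obtain b c where bc: "d = b * c" "b dvd p ^ a" "c dvd m"
      using division_decomp by blast
    obtain i where "i \<le> a" "b = p ^ i"
      using bc(2) assms(1) divides_primepow_nat by blast
    then show "d \<in> (\<lambda>(i, d). p ^ i * d) ` ({..a} \<times> {d. d dvd m})"
      using bc by force
  qed
  then have "card {d. d dvd p ^ a * m} \<le> card ({..a} \<times> {d. d dvd m})"
    using assms(2) by (intro surj_card_le) auto
  then show ?thesis by (simp add: card_cartesian_product)
qed

text \<open>With \<open>c = \<epsilon> * ln 2\<close> the power on the right is
  \<open>exp (a * c) \<ge> 1 + a * c\<close>, and the constant makes up for a small
  \<open>c\<close>. This is the price of one small prime in the divisor bound.\<close>

lemma linear_le_two_powr: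
  fixes \<epsilon> :: real
  assumes "\<epsilon> > 0"
  shows "real a + 1 \<le> (1 + 1 / (\<epsilon> * ln 2)) * (2 powr \<epsilon>) ^ a"
proof -
  define c where "c = \<epsilon> * ln (2::real)"
  have c: "c > 0" using assms by (simp add: c_def)
  have "(2 powr \<epsilon>) ^ a = exp (real a * c)"
    by (simp add: powr_def c_def flip: exp_of_nat_mult)
  moreover have "1 + real a * c \<le> exp (real a * c)" by (rule exp_ge_add_one_self)
  moreover have "real a + 1 \<le> (1 + 1 / c) * (1 + real a * c)"
    using c by (simp add: field_simps)
  ultimately show ?thesis
    using c unfolding c_def[symmetric]
    by (smt (verit, best) divide_nonneg_nonneg mult_left_mono zero_le_one)
qed

text \<open>Only the finitely many primes \<open>p\<close> with \<open>p powr \<epsilon> < 2\<close> cost a constant factor.\<close>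

theorem card_divisors_le_powr:
  fixes \<epsilon> :: real
  assumes "\<epsilon> > 0"
  shows "\<exists>C\<ge>1. \<forall>n>0. real (card {d :: nat. d dvd n}) \<le> C * real n powr \<epsilon>"
proof -
  define S where "S = {p :: nat. prime p \<and> real p powr \<epsilon> < 2}"
  define K where "K = 1 + 1 / (\<epsilon> * ln 2)"
  have K1: "K \<ge> 1" using assms by (simp add: K_def)
  have finS: "finite S"
  proof (rule finite_subset)
    show "S \<subseteq> {.. nat \<lceil>2 powr (1 / \<epsilon>)\<rceil>}"
    proof
      fix p assume p: "p \<in> S"
      then have "(real p powr \<epsilon>) powr (1 / \<epsilon>) \<le> 2 powr (1 / \<epsilon>)"
        using assms by (intro powr_mono2) (auto simp: S_def)
      then have "real p \<le> 2 powr (1 / \<epsilon>)" using assms by (simp add: powr_powr)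
      then show "p \<in> {.. nat \<lceil>2 powr (1 / \<epsilon>)\<rceil>}" by (simp add: le_nat_iff ceiling_mono) linarith
    qed
  qed simp
  \<comment> \<open>The exponent of \<open>K\<close> counts only the small primes dividing
    \<open>n\<close>, so the induction, which strips the full power of one prime, pays
    \<open>K\<close> only when that prime lies in \<open>S\<close>; for other primes
    \<open>a + 1 \<le> 2 ^ a\<close> suffices.\<close>
  have main: "real (card {d. d dvd n}) \<le> K ^ card {p \<in> S. p dvd n} * real n powr \<epsilon>" if "n > 0" for n :: nat
    using that
  proof (induction n rule: less_induct)
    case (less n)
    show ?case
    proof (cases "n = 1")
      case True
      then show ?thesis using K1 by (simp add: one_le_power)
    next
      case False
      then obtain p where p: "prime p" "p dvd n" using prime_factor_nat by blast
      then obtain a m where am: "n = p ^ a * m" "\<not> p dvd m" 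
        using multiplicity_decompose'[of n p] less.prems by (metis not_prime_unit gr_implies_not0)
      have a: "a > 0" using am p(2) gr0I by fastforce
      have m: "m > 0" using am(1) less.prems gr0I by fastforce
      have "m < n" unfolding am(1) using one_less_power[OF prime_gt_1_nat[OF p(1)] a] m 
        by (intro n_less_m_mult_n) auto
      note IH = less.IH[OF this m]
      have "real (card {d. d dvd n}) \<le> real ((a + 1) * card {d. d dvd m})"
        unfolding am(1) by (rule of_nat_mono) (rule card_divisors_prime_power_mult[OF p(1) m])
      also have "\<dots> = (real a + 1) * real (card {d. d dvd m})" by (simp only: of_nat_mult of_nat_add of_nat_1)
      also have "\<dots> \<le> (real a + 1) * (K ^ card {q \<in> S. q dvd m} * real m powr \<epsilon>)"
        using IH by (intro mult_left_mono) auto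
      also have "\<dots> \<le> K ^ card {q \<in> S. q dvd n} * real n powr \<epsilon>"
      proof -
        have np: "real n powr \<epsilon> = (real p powr \<epsilon>) ^ a * real m powr \<epsilon>"
        proof -
          have "real n powr \<epsilon> = (real p ^ a) powr \<epsilon> * real m powr \<epsilon>"
            unfolding am(1) by (simp add: powr_mult)
          also have "(real p ^ a) powr \<epsilon> = (real p powr \<epsilon>) ^ a"
            using p(1) by (simp add: prime_gt_0_nat powr_powr mult.commute flip: powr_realpow)
          finally show ?thesis .
        qed
        have p2: "2 powr \<epsilon> \<le> real p powr \<epsilon>"
          using assms p(1) by (intro powr_mono2) (auto dest: prime_ge_2_nat)
        show ?thesis
        proof (cases "p \<in> S")
          case True
          have eq: "{q \<in> S. q dvd n} = insert p {q \<in> S. q dvd m}"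
            using am p True a 
            by (auto simp: S_def prime_dvd_mult_iff prime_dvd_power_iff dest: primes_dvd_imp_eq)
          have cd: "card {q \<in> S. q dvd n} = Suc (card {q \<in> S. q dvd m})"
            unfolding eq using am(2) finS by simp
          have "real a + 1 \<le> K * (2 powr \<epsilon>) ^ a"
            using linear_le_two_powr[OF assms] by (simp add: K_def)
          also have "\<dots> \<le> K * (real p powr \<epsilon>) ^ a"
            using p2 K1 by (intro mult_left_mono power_mono) auto
          finally have "(real a + 1) * (K ^ card {q \<in> S. q dvd m} * real m powr \<epsilon>) 
              \<le> (K * (real p powr \<epsilon>) ^ a) * (K ^ card {q \<in> S. q dvd m} * real m powr \<epsilon>)"
            using K1 by (intro mult_right_mono) auto
          then show ?thesis unfolding cd np by (simp add: mult_ac)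
        next
          case False
          then have ge2: "real p powr \<epsilon> \<ge> 2" using p(1) by (simp add: S_def)
          have "card {q \<in> S. q dvd m} \<le> card {q \<in> S. q dvd n}"
            using finS am(1) by (intro card_mono) auto
          then have Kp: "K ^ card {q \<in> S. q dvd m} \<le> K ^ card {q \<in> S. q dvd n}"
            using K1 by (intro power_increasing) auto
          have "real a + 1 \<le> 2 ^ a" using less_exp[of a] 
            by (metis Suc_eq_plus1 Suc_leI of_nat_1 of_nat_add of_nat_le_iff of_nat_numeral of_nat_power)
          also have "\<dots> \<le> (real p powr \<epsilon>) ^ a" using ge2 by (intro power_mono) auto
          finally have "(real a + 1) * (K ^ card {q \<in> S. q dvd m} * real m powr \<epsilon>) 
            \<le> (real p powr \<epsilon>) ^ a * (K ^ card {q \<in> S. q dvd n} * real m powr \<epsilon>)"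
            using Kp K1 by (intro mult_mono) auto
          then show ?thesis unfolding np by (simp add: mult_ac)
        qed
      qed
      finally show ?thesis .
    qed
  qed
  show ?thesis
  proof (intro exI[of _ "K ^ card S"] conjI allI impI)
    show "1 \<le> K ^ card S" using K1 by (simp add: one_le_power)
    fix n :: nat assume "n > 0"
    have "K ^ card {p \<in> S. p dvd n} \<le> K ^ card S"
      using K1 finS by (intro power_increasing card_mono) auto
    then show "real (card {d. d dvd n}) \<le> K ^ card S * real n powr \<epsilon>"
      using main[OF \<open>n > 0\<close>] by (smt (verit) mult_right_mono powr_ge_zero)
  qed
qed

section \<open>Harmonic sums and a uniform divisor bound\<close>

lemma sum_inverse_le_ln: 
  fixes h :: real
  assumes "h \<ge> 1"
  shows "(\<Sum>j = 1..nat \<lfloor>h\<rfloor>. 1 / real j) \<le> 1 + ln h"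
proof -
  have "(\<Sum>j = 1..Suc N. 1 / real j) \<le> 1 + ln (real (Suc N))" for N
  proof (induction N)
    case (Suc N)
    have "1 / real (Suc (Suc N)) \<le> ln (real (Suc (Suc N))) - ln (real (Suc N))"
    proof -
      have "ln (real (Suc N) / real (Suc (Suc N))) \<le> real (Suc N) / real (Suc (Suc N)) - 1"
        by (rule ln_le_minus_one) simp
      also have "\<dots> = - 1 / real (Suc (Suc N))" by (simp add: field_simps)
      finally show ?thesis by (simp add: ln_div)
    qed
    then show ?case using Suc by simp
  qed simp
  moreover obtain N where N: "nat \<lfloor>h\<rfloor> = Suc N" using assms by (cases "nat \<lfloor>h\<rfloor>") auto
  moreover have "ln (real (Suc N)) \<le> ln h"
    using assms N by (intro ln_mono) (auto, linarith)
  ultimately show ?thesis by (smt (verit, best))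
qed

text \<open>\<open>D\<close> stands for the factor H^o(1): the counting lemmas carry it as a
  parameter, and only at the end is it replaced by a small power of \<open>H\<close>.\<close>

definition divisor_bound :: "real \<Rightarrow> real \<Rightarrow> bool" where
  "divisor_bound X D \<longleftrightarrow> (\<forall>n :: nat. 0 < n \<and> real n \<le> X \<longrightarrow> real (card {d. d dvd n}) \<le> D)"

lemma divisor_boundD: "divisor_bound X D \<Longrightarrow> 0 < n \<Longrightarrow> real n \<le> X \<Longrightarrow> real (card {d. d dvd n}) \<le> D"
  by (auto simp: divisor_bound_def)

lemma divisor_bound_mono: "divisor_bound X D \<Longrightarrow> Y \<le> X \<Longrightarrow> divisor_bound Y D"
  by (auto simp: divisor_bound_def)

lemma divisor_bound_ge_1: "divisor_bound X D \<Longrightarrow> 1 \<le> X \<Longrightarrow> 1 \<le> D"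
  using divisor_boundD[of X D 1] by simp

section \<open>Numerators and denominators\<close>

definition rnum :: "rat \<Rightarrow> int" where "rnum x = fst (quotient_of x)"
definition rden :: "rat \<Rightarrow> nat" where "rden x = nat (snd (quotient_of x))"

lemma rden_pos: "rden x > 0"
  using quotient_of_denom_pos'[of x] by (simp add: rden_def)

lemma coprime_rnum_rden: "coprime (rnum x) (int (rden x))"
  using quotient_of_coprime[of x] quotient_of_denom_pos'[of x]
  by (metis rnum_def rden_def int_nat_eq less_imp_le prod.collapse)

lemma rat_eq_rnum_div_rden: "x = of_int (rnum x) / of_nat (rden x)"
  using quotient_of_div[of x] quotient_of_denom_pos'[of x]
  by (metis rnum_def rden_def int_nat_eq less_imp_le of_int_of_nat_eq prod.collapse)

lemma rnum_rden_unique: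
  assumes "b > 0" "coprime a (int b)"
  shows "rnum (of_int a / of_nat b) = a" "rden (of_int a / of_nat b) = b"
proof -
  have "quotient_of (of_int a / of_nat b) = (a, int b)"
    using assms quotient_of_Fract[of a "int b"] by (simp add: Fract_of_int_quotient normalize_stable)
  then show "rnum (of_int a / of_nat b) = a" "rden (of_int a / of_nat b) = b"
    by (auto simp: rnum_def rden_def)
qed

text \<open>Integrality is stable under ring operations, so this criterion turns identities between
  rationals into divisibilities between their denominators. The converse direction rests on
  coprimality of numerator and denominator.\<close>

lemma rden_dvd_iff: "rden x dvd m \<longleftrightarrow> of_nat m * x \<in> \<int>"
proof
  assume "rden x dvd m"
  then obtain k where "m = rden x * k" by blast
  then have "of_nat m * x = of_int (int k * rnum x)"
    using rden_pos[of x] by (subst rat_eq_rnum_div_rden) simp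
  then show "of_nat m * x \<in> \<int>" by simp
next
  assume "of_nat m * x \<in> \<int>"
  then obtain z where "of_nat m * x = of_int z" by (auto elim: Ints_cases)
  then have "(of_int (int m * rnum x) :: rat) = of_int (z * int (rden x))"
    using rden_pos[of x] by (subst (asm) rat_eq_rnum_div_rden[of x]) (simp add: field_simps)
  then have "int m * rnum x = z * int (rden x)" by (simp only: of_int_eq_iff)
  then have "int (rden x) dvd int m * rnum x" by simp
  then show "rden x dvd m"
    using coprime_rnum_rden[of x] by (simp add: coprime_dvd_mult_left_iff coprime_commute)
qed

lemma farey_rats_iff: "x \<in> farey_rats H \<longleftrightarrow> \<bar>real_of_int (rnum x)\<bar> \<le> H \<and> real (rden x) \<le> H"
proof
  assume "x \<in> farey_rats H"
  then obtain a b where ab: "x = of_int a / of_int b" "0 < b" "\<bar>real_of_int a\<bar> \<le> H"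
    "real_of_int b \<le> H" "coprime a b" by (auto simp: farey_rats_def)
  have "x = of_int a / of_nat (nat b)" using ab by simp
  then show "\<bar>real_of_int (rnum x)\<bar> \<le> H \<and> real (rden x) \<le> H"
    using rnum_rden_unique[of "nat b" a] ab by simp
next
  assume "\<bar>real_of_int (rnum x)\<bar> \<le> H \<and> real (rden x) \<le> H"
  then show "x \<in> farey_rats H" unfolding farey_rats_def
    using rat_eq_rnum_div_rden[of x] rden_pos[of x] coprime_rnum_rden[of x]
    by (intro CollectI exI[of _ "rnum x"] exI[of _ "int (rden x)"]) auto
qed

lemma rat_eqI: "rnum x = rnum y \<Longrightarrow> rden x = rden y \<Longrightarrow> x = y"
  by (metis rat_eq_rnum_div_rden)

lemma rden_diff_dvd_lcm: "rden (x - y) dvd lcm (rden x) (rden y)"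
proof -
  have "of_nat (lcm (rden x) (rden y)) * x \<in> \<int>" "of_nat (lcm (rden x) (rden y)) * y \<in> \<int>"
    by (auto simp flip: rden_dvd_iff)
  then show ?thesis by (simp add: rden_dvd_iff right_diff_distrib)
qed

section \<open>Counting fractions, and integers in a residue class\<close>

lemma farey_rats_subset: 
  "farey_rats H \<subseteq> (\<lambda>(a, b). of_int a / of_nat b) ` ({- \<lfloor>H\<rfloor>..\<lfloor>H\<rfloor>} \<times> {1..nat \<lfloor>H\<rfloor>})"
proof
  fix x assume x: "x \<in> farey_rats H"
  have "(rnum x, rden x) \<in> {- \<lfloor>H\<rfloor>..\<lfloor>H\<rfloor>} \<times> {1..nat \<lfloor>H\<rfloor>}"
    using x rden_pos[of x] by (auto simp: farey_rats_iff le_floor_iff le_nat_floor abs_le_iff)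
      linarith
  then show "x \<in> (\<lambda>(a, b). of_int a / of_nat b) ` ({- \<lfloor>H\<rfloor>..\<lfloor>H\<rfloor>} \<times> {1..nat \<lfloor>H\<rfloor>})"
    using rat_eq_rnum_div_rden[of x] by force
qed

lemma finite_farey_rats [simp, intro]: "finite (farey_rats H)"
  by (rule finite_subset[OF farey_rats_subset]) auto

lemma card_farey_rats:
  assumes "H \<ge> 1"
  shows "card (farey_rats H) \<le> 3 * (nat \<lfloor>H\<rfloor>)\<^sup>2"
proof -
  have "card (farey_rats H) \<le> card ({- \<lfloor>H\<rfloor>..\<lfloor>H\<rfloor>} \<times> {1..nat \<lfloor>H\<rfloor>})"
    by (rule surj_card_le[OF _ farey_rats_subset]) auto
  also have "\<dots> = nat (2 * \<lfloor>H\<rfloor> + 1) * nat \<lfloor>H\<rfloor>"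
    by (simp add: card_cartesian_product algebra_simps)
  also have "nat (2 * \<lfloor>H\<rfloor> + 1) \<le> 3 * nat \<lfloor>H\<rfloor>" using assms by linarith
  finally show ?thesis by (simp add: power2_eq_square)
qed

text \<open>With \<open>m = Min S\<close>, sending \<open>x\<close> to \<open>(x - m) div k\<close>
  is injective into the integers from 0 to \<open>L / k\<close>. It serves for numerators in a
  residue class and, with \<open>k = 1\<close>, for integers in an interval.\<close>

lemma card_le_if_spaced:
  fixes S :: "int set" and k :: int and L :: real
  assumes "finite S" "k > 0" "L \<ge> 0"
    and dvd: "\<And>x y. x \<in> S \<Longrightarrow> y \<in> S \<Longrightarrow> k dvd x - y"
    and le: "\<And>x y. x \<in> S \<Longrightarrow> y \<in> S \<Longrightarrow> real_of_int (x - y) \<le> L"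
  shows "real (card S) \<le> L / k + 1"
proof (cases "S = {}")
  case False
  define m where "m = Min S"
  have m: "m \<in> S" "\<And>x. x \<in> S \<Longrightarrow> m \<le> x" using assms(1) False by (auto simp: m_def)
  have "inj_on (\<lambda>x. (x - m) div k) S"
  proof (rule inj_onI)
    fix x y assume xy: "x \<in> S" "y \<in> S" "(x - m) div k = (y - m) div k"
    then have "x - m = y - m" using dvd[OF xy(1) m(1)] dvd[OF xy(2) m(1)] 
      by (metis dvd_div_mult_self)
    then show "x = y" by simp
  qed
  moreover have "(\<lambda>x. (x - m) div k) ` S \<subseteq> {0..\<lfloor>L / k\<rfloor>}"
  proof safe
    fix x assume x: "x \<in> S"
    obtain z where z: "x - m = k * z" using dvd[OF x m(1)] by blast
    have "z \<ge> 0" using z m(2)[OF x] assms(2) by (smt (verit) mult_pos_neg)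
    have "real_of_int k * real_of_int z \<le> L" using le[OF x m(1)] z by (metis of_int_mult)
    then have "real_of_int z \<le> L / k" using assms(2) by (simp add: field_simps)
    then show "(x - m) div k \<in> {0..\<lfloor>L / k\<rfloor>}" using z \<open>z \<ge> 0\<close> assms(2) by (simp add: le_floor_iff)
  qed
  ultimately have "card S \<le> card {0..\<lfloor>L / k\<rfloor>}" by (intro card_inj_on_le) auto
  also have "\<dots> = nat (\<lfloor>L / k\<rfloor> + 1)" by simp
  finally have "real (card S) \<le> real (nat (\<lfloor>L / k\<rfloor> + 1))" by simp
  moreover have "\<lfloor>L / k\<rfloor> \<ge> 0" using assms by simp
  ultimately show ?thesis by linarith
qed (use assms in simp)

text \<open>For \<open>v = g * j\<close> with \<open>g = gcd q v\<close> the term equals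
  \<open>1 / j\<close>. The pair \<open>(g, j)\<close> determines \<open>v\<close>, so passing to
  all pairs with \<open>g dvd q\<close> and \<open>j \<le> N\<close> only increases the sum.\<close>

lemma sum_gcd_div_le:
  fixes q N :: nat
  assumes "q > 0"
  shows "(\<Sum>v = 1..N. real (gcd q v) / real v) \<le> real (card {d. d dvd q}) * (\<Sum>j = 1..N. 1 / real j)"
proof -
  have "(\<Sum>v = 1..N. real (gcd q v) / real v) \<le> (\<Sum>(g, j) \<in> {d. d dvd q} \<times> {1..N}. 1 / real j)"
  proof (rule sum_le_included[where i = "\<lambda>(g, j). g * j"])
    show "\<forall>v\<in>{1..N}. \<exists>y\<in>{d. d dvd q} \<times> {1..N}. (case y of (g, j) \<Rightarrow> g * j) = v \<and>
      real (gcd q v) / real v \<le> (case y of (g, j) \<Rightarrow> 1 / real j)"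
    proof
      fix v assume v: "v \<in> {1..N}"
      define j where "j = v div gcd q v"
      have vj: "v = gcd q v * j" by (simp add: j_def)
      have g0: "gcd q v > 0" using assms by simp
      have "j \<ge> 1" using vj v by (metis One_nat_def Suc_leI atLeastAtMost_iff gr0I mult_0_right not_one_le_zero)
      moreover have "j \<le> N" using v unfolding j_def by (meson atLeastAtMost_iff div_le_dividend le_trans)
      moreover have "real (gcd q v) / real v = 1 / real j"
        using g0 by (subst (2) vj) simp
      ultimately show "\<exists>y\<in>{d. d dvd q} \<times> {1..N}. (case y of (g, j) \<Rightarrow> g * j) = v \<and>
          real (gcd q v) / real v \<le> (case y of (g, j) \<Rightarrow> 1 / real j)"
        using vj by (intro bexI[of _ "(gcd q v, j)"]) auto
    qed
  qed (use assms in auto)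
  also have "\<dots> = real (card {d. d dvd q}) * (\<Sum>j = 1..N. 1 / real j)"
    by (simp flip: sum.cartesian_product)
  finally show ?thesis .
qed

lemma rden_uminus [simp]: "rden (- x) = rden x"
proof -
  have "rden (- x) dvd rden x" for x
    using rden_dvd_iff[of x "rden x"] by (simp add: rden_dvd_iff)
  from this[of x] this[of "- x"] show ?thesis by (simp add: dvd_antisym)
qed

lemma rden_add_dvd_lcm: "rden (x + y) dvd lcm (rden x) (rden y)"
  using rden_diff_dvd_lcm[of x "- y"] by simp

lemma rden_0 [simp]: "rden 0 = 1" and rnum_0 [simp]: "rnum 0 = 0"
  by (simp_all add: rden_def rnum_def)

section \<open>The denominator weight\<close>

text \<open>At \<open>R = 1\<close> this is the indicator of the integers, which dominates that of
  0. The cutoff \<open>R\<close> grows with every convolution but keeps the denominators bounded, so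
  that a single divisor bound applies.\<close>

definition den_weight :: "real \<Rightarrow> rat \<Rightarrow> real" where
  "den_weight R c = (if real (rden c) \<le> R then 1 / real (rden c) else 0)"

lemma den_weight_nonneg [simp]: "den_weight R c \<ge> 0"
  by (simp add: den_weight_def)

lemma den_weight_le_1: "den_weight R c \<le> 1"
  using rden_pos[of c] by (simp add: den_weight_def)

lemma den_weight_mono: "R \<le> R' \<Longrightarrow> den_weight R c \<le> den_weight R' c"
  by (simp add: den_weight_def)

text \<open>The difference of two such fractions with numerators \<open>a\<close>, \<open>b\<close>
  is \<open>(a - b) / v\<close>, and \<open>d\<close> clears it, so \<open>v\<close> divides
  \<open>d * (a - b)\<close> and \<open>v div gcd v d\<close> divides \<open>a - b\<close>. The
  numerators lie in an interval of length \<open>2 * h\<close>.\<close>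

lemma card_farey_rats_fixed_dens:
  assumes "h \<ge> 1" "v > 0" "d > 0" "real v \<le> h"
  shows "real (card {x \<in> farey_rats h. rden x = v \<and> rden (c - x) = d}) \<le> 3 * h / lcm v d * d"
    (is "real (card ?A) \<le> _")
proof -
  define k where "k = v div gcd v d"
  have vk: "v = k * gcd v d" by (simp add: k_def)
  have k0: "k > 0" using vk assms(2) by (cases k) auto
  have kv: "k \<le> v" unfolding k_def by simp
  have inj: "inj_on rnum ?A" by (rule inj_onI) (auto intro: rat_eqI)
  have "real (card (rnum ` ?A)) \<le> 2 * h / int k + 1"
  proof (rule card_le_if_spaced)
    fix a b assume "a \<in> rnum ` ?A" "b \<in> rnum ` ?A"
    then obtain x y where xy: "x \<in> ?A" "y \<in> ?A" "a = rnum x" "b = rnum y" by blast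
    show "real_of_int (a - b) \<le> 2 * h"
      using xy by (auto simp: farey_rats_iff)
    have "of_nat d * (c - y) - of_nat d * (c - x) \<in> \<int>"
      using xy by (intro Ints_diff) (auto simp flip: rden_dvd_iff)
    moreover have "of_nat d * (c - y) - of_nat d * (c - x) = of_nat d * (x - y)"
      by (simp add: algebra_simps)
    moreover have "x - y = of_int (a - b) / of_nat v"
      using xy rat_eq_rnum_div_rden[of x] rat_eq_rnum_div_rden[of y]
      by (simp add: diff_divide_distrib)
    ultimately have "of_nat d * (of_int (a - b) / of_nat v :: rat) \<in> \<int>" by simp
    then obtain z where "of_nat d * (of_int (a - b) / of_nat v :: rat) = of_int z"
      by (auto elim: Ints_cases)
    then have "(of_int (int d * (a - b)) :: rat) = of_int (z * int v)"
      using assms(2) by (simp add: field_simps)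
    then have "int v dvd int d * (a - b)" by (metis of_int_eq_iff dvd_triv_right)
    moreover have "coprime k (d div gcd v d)"
      using assms(2) unfolding k_def by (intro div_gcd_coprime) auto
    moreover have "int v = int (gcd v d) * int k" using vk by (metis mult.commute of_nat_mult)
    moreover have "int d = int (gcd v d) * int (d div gcd v d)" 
      by (metis dvd_mult_div_cancel gcd_dvd2 of_nat_mult)
    ultimately have "int k dvd int (d div gcd v d) * (a - b)" 
      using assms(2) by (metis dvd_times_left_cancel_iff gcd_eq_0_iff mult.assoc of_nat_eq_0_iff not_less0)
    then show "int k dvd a - b" using \<open>coprime k (d div gcd v d)\<close>
      by (simp add: coprime_dvd_mult_right_iff)
  qed (use assms k0 in auto)
  \<comment> \<open>\<open>k \<le> v \<le> h\<close> gives \<open>1 \<le> h / k\<close>, which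
    absorbs the summand 1.\<close>
  also have "\<dots> \<le> 3 * h / k" using k0 kv assms by (simp add: field_simps)
  also have "real k = real (lcm v d) / real d"
    using assms vk by (simp add: lcm_nat_def k_def real_of_nat_div field_simps)
  finally show ?thesis using assms by (simp add: card_image[OF inj])
qed

text \<open>Put \<open>q = den c\<close>, \<open>v = den x\<close> and \<open>d = den (c - x)\<close>. For fixed \<open>v\<close> and \<open>d\<close> the numerators of \<open>x\<close>
  are congruent modulo \<open>v / gcd v d\<close>, so these \<open>x\<close> contribute at most \<open>3 h / lcm v d \<le> 3 h / lcm v q\<close>,
  and there are few \<open>d\<close> as \<open>d\<close> divides \<open>q v\<close>.\<close>

lemma sum_den_weight_farey_rats:
  assumes h: "h \<ge> 1" and R: "R \<ge> 1" and D: "divisor_bound (R * h * h) D"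
  shows "(\<Sum>x\<in>farey_rats h. den_weight R (c - x)) \<le> 3 * D\<^sup>2 * (1 + ln h) * h * den_weight (R * h) c"
proof (cases "real (rden c) \<le> R * h")
  case False
  \<comment> \<open>Both sides vanish here: if \<open>c - x\<close> had denominator at most
    \<open>R\<close>, then \<open>c = (c - x) + x\<close> would have one at most
    \<open>R * h\<close>.\<close>
  have "den_weight R (c - x) = 0" if "x \<in> farey_rats h" for x
  proof (rule ccontr)
    assume "den_weight R (c - x) \<noteq> 0"
    then have *: "real (rden (c - x)) \<le> R" by (auto simp: den_weight_def split: if_splits)
    have "rden c dvd lcm (rden (c - x)) (rden x)"
      using rden_add_dvd_lcm[of "c - x" x] by simp
    then have "rden c \<le> rden (c - x) * rden x"
      using dvd_trans[OF _ lcm_least[OF dvd_triv_left dvd_triv_right]] 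
      by (intro dvd_imp_le) (auto simp: rden_pos)
    then have "real (rden c) \<le> real (rden (c - x)) * real (rden x)" by (metis of_nat_le_iff of_nat_mult)
    also have "\<dots> \<le> R * h" using * that R by (intro mult_mono) (auto simp: farey_rats_iff)
    finally show False using False by simp
  qed
  then show ?thesis using False by (simp add: den_weight_def)
next
  case True
  define q N where "q = rden c" and "N = nat \<lfloor>h\<rfloor>"
  have q: "q > 0" by (simp add: q_def rden_pos)
  have Rh: "1 * 1 \<le> R * h" using h R by (intro mult_mono) auto
  then have Rhh: "R * h \<le> R * h * h" using h mult_left_mono[of 1 h "R * h"] by simp
  then have D1: "D \<ge> 1" using divisor_bound_ge_1[OF D] Rh by linarith
  have inner: "(\<Sum>x | x \<in> farey_rats h \<and> rden x = v. den_weight R (c - x)) \<le> D * (3 * h / lcm q v)"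
    if v: "v \<in> {1..N}" for v
  proof -
    have vh: "real v \<le> h" using v unfolding N_def by (simp add: le_nat_floor nat_le_iff) linarith
    have v0: "v > 0" using v by simp
    define G where "G = {x \<in> farey_rats h. rden x = v}"
    have finG: "finite G" by (simp add: G_def)
    define E where "E = (\<lambda>x. rden (c - x)) ` G"
    \<comment> \<open>\<open>d\<close> divides \<open>lcm q v\<close> as the denominator of
      \<open>c - x\<close>, and \<open>q\<close> divides \<open>lcm v d\<close> because
      \<open>c = (c - x) + x\<close>. The latter lets \<open>lcm q v\<close> replace
      \<open>lcm v d\<close>, which removes \<open>d\<close> from the bound.\<close>
    have Edvd: "d dvd q * v \<and> lcm q v dvd lcm v d \<and> d > 0" if dE: "d \<in> E" for d
    proof -
      obtain x where x: "x \<in> G" "d = rden (c - x)" using dE unfolding E_def by blast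
      have "d dvd lcm q v" using rden_diff_dvd_lcm[of c x] x by (simp add: G_def q_def)
      then have "d dvd q * v" by (rule dvd_trans[OF _ lcm_least[OF dvd_triv_left dvd_triv_right]])
      moreover have "q dvd lcm v d" using rden_add_dvd_lcm[of "c - x" x] x 
        by (simp add: G_def q_def lcm.commute)
      ultimately show ?thesis using x(2) rden_pos[of "c - x"] by simp
    qed
    have "(\<Sum>x\<in>G. den_weight R (c - x)) \<le> (\<Sum>x\<in>G. 1 / real (rden (c - x)))"
      by (intro sum_mono) (auto simp: den_weight_def)
    also have "\<dots> = (\<Sum>d\<in>E. \<Sum>x | x \<in> G \<and> rden (c - x) = d. 1 / real (rden (c - x)))"
      unfolding E_def by (rule sum.image_gen[OF finG])
    also have "\<dots> = (\<Sum>d\<in>E. real (card {x \<in> G. rden (c - x) = d}) / real d)"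
      by (intro sum.cong) auto
    also have "\<dots> \<le> (\<Sum>d\<in>E. 3 * h / lcm q v)"
    proof (rule sum_mono)
      fix d assume "d \<in> E"
      note d = Edvd[OF this]
      have "real (card {x \<in> G. rden (c - x) = d}) \<le> 3 * h / lcm v d * d"
        using card_farey_rats_fixed_dens[OF h v0 _ vh, of d c] d by (simp add: G_def conj_assoc)
      then have "real (card {x \<in> G. rden (c - x) = d}) / d \<le> 3 * h / lcm v d"
        using d by (simp add: field_simps)
      also have "\<dots> \<le> 3 * h / lcm q v"
        using d v0 q h by (intro divide_left_mono) (auto intro!: dvd_imp_le simp: lcm_pos_nat)
      finally show "real (card {x \<in> G. rden (c - x) = d}) / d \<le> 3 * h / lcm q v" .
    qed
    also have "\<dots> = real (card E) * (3 * h / lcm q v)" by simp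
    also have "\<dots> \<le> D * (3 * h / lcm q v)"
    proof (rule mult_right_mono)
      have "card E \<le> card {d. d dvd q * v}"
        using Edvd q v0 by (intro card_mono) auto
      moreover have "real (q * v) \<le> R * h * h"
        using True vh h R unfolding q_def by (simp add: mult_mono)
      ultimately show "real (card E) \<le> D"
        using divisor_boundD[OF D, of "q * v"] q v0 by fastforce
    qed (use h in auto)
    finally show ?thesis by (simp add: G_def)
  qed
  have "(\<Sum>x\<in>farey_rats h. den_weight R (c - x)) = 
      (\<Sum>v\<in>{1..N}. \<Sum>x | x \<in> farey_rats h \<and> rden x = v. den_weight R (c - x))"
    by (rule sum.group[symmetric]) 
       (use h in \<open>auto simp: N_def farey_rats_iff le_nat_iff le_floor_iff Suc_le_eq rden_pos\<close>)
  also have "\<dots> \<le> (\<Sum>v\<in>{1..N}. D * (3 * h / lcm q v))"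
    by (intro sum_mono inner)
  \<comment> \<open>\<open>lcm q v = q * v / gcd q v\<close> extracts the weight
    \<open>1 / q\<close> of \<open>c\<close>.\<close>
  also have "\<dots> = 3 * D * h / q * (\<Sum>v = 1..N. real (gcd q v) / real v)"
    unfolding sum_distrib_left
  proof (rule sum.cong)
    fix v assume "v \<in> {1..N}"
    then have "real (lcm q v) = real q * real v / real (gcd q v)"
      using q by (simp add: lcm_nat_def real_of_nat_div)
    then show "D * (3 * h / real (lcm q v)) = 3 * D * h / real q * (real (gcd q v) / real v)"
      using q \<open>v \<in> {1..N}\<close> by (simp add: field_simps)
  qed simp
  also have "\<dots> \<le> 3 * D * h / q * (D * (1 + ln h))"
  proof (rule mult_left_mono)
    have "real (card {d. d dvd q}) \<le> D"
      using divisor_boundD[OF D, of q] q True Rhh by (simp add: q_def)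
    then show "(\<Sum>v = 1..N. real (gcd q v) / real v) \<le> D * (1 + ln h)"
      using sum_gcd_div_le[OF q, of N] sum_inverse_le_ln[OF h] D1 unfolding N_def
      by (smt (verit) mult_mono of_nat_0_le_iff sum_nonneg divide_nonneg_nonneg)
  qed (use D1 h in auto)
  also have "\<dots> = 3 * D\<^sup>2 * (1 + ln h) * h * den_weight (R * h) c"
    using True by (simp add: den_weight_def q_def power2_eq_square)
  finally show ?thesis .
qed

section \<open>Iterated convolution\<close>

text \<open>For empty \<open>I\<close> the indicator of \<open>c = 0\<close> is at most
  \<open>den_weight 1 c\<close>. Each further coordinate is one convolution, which costs a factor
  \<open>B\<close> and multiplies the cutoff by \<open>Q\<close>. The cutoff never exceeds
  \<open>Q ^ k\<close>, so \<open>step\<close> is asked for only up to there.\<close>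

lemma card_PiE_sum_eq_le:
  fixes g :: "'b \<Rightarrow> rat" and c :: rat
  assumes "finite I" "finite S" "B \<ge> 0" "Q \<ge> 1" "card I \<le> k"
    and step: "\<And>R c. 1 \<le> R \<Longrightarrow> R * Q \<le> Q ^ k \<Longrightarrow> 
      (\<Sum>s\<in>S. den_weight R (c - g s)) \<le> B * den_weight (R * Q) c"
  shows "real (card {s \<in> I \<rightarrow>\<^sub>E S. (\<Sum>i\<in>I. g (s i)) = c}) \<le> B ^ card I * den_weight (Q ^ card I) c"
  using assms(1,5)
proof (induction I arbitrary: c rule: finite_induct)
  case empty
  have "{s \<in> {} \<rightarrow>\<^sub>E S. (\<Sum>i\<in>{}. g (s i)) = c} = (if c = 0 then {\<lambda>_. undefined} else {})"
    by auto
  then show ?case by (cases "c = 0") (simp_all add: den_weight_def)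
next
  case (insert i I)
  let ?T = "\<lambda>c. {s \<in> I \<rightarrow>\<^sub>E S. (\<Sum>i\<in>I. g (s i)) = c}"
  let ?U = "{s \<in> insert i I \<rightarrow>\<^sub>E S. (\<Sum>i\<in>insert i I. g (s i)) = c}"
  have fin: "finite (?T c)" for c using insert assms(2) by (auto intro!: finite_PiE)
  have "?U \<subseteq> (\<lambda>(x, t). t(i := x)) ` (SIGMA x:S. ?T (c - g x))"
  proof
    fix s assume s: "s \<in> ?U"
    have "(\<Sum>j\<in>I. g ((s(i := undefined)) j)) = (\<Sum>j\<in>I. g (s j))"
      using insert by (intro sum.cong) auto
    then have "s(i := undefined) \<in> ?T (c - g (s i))"
      using s insert by (auto simp: PiE_iff extensional_def)
    then show "s \<in> (\<lambda>(x, t). t(i := x)) ` (SIGMA x:S. ?T (c - g x))"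
      using s by (intro image_eqI[of _ _ "(s i, s(i := undefined))"]) auto
  qed
  then have "card ?U \<le> card (SIGMA x:S. ?T (c - g x))"
    using fin assms(2) by (intro surj_card_le) auto
  also have "\<dots> = (\<Sum>x\<in>S. card (?T (c - g x)))" using fin assms(2) by simp
  finally have "real (card ?U) \<le> (\<Sum>x\<in>S. real (card (?T (c - g x))))" 
    unfolding of_nat_sum[symmetric] by (rule of_nat_mono)
  also have "\<dots> \<le> (\<Sum>x\<in>S. B ^ card I * den_weight (Q ^ card I) (c - g x))"
    using insert by (intro sum_mono insert.IH) auto
  also have "\<dots> = B ^ card I * (\<Sum>x\<in>S. den_weight (Q ^ card I) (c - g x))"
    by (simp add: sum_distrib_left)
  also have "\<dots> \<le> B ^ card I * (B * den_weight (Q ^ card I * Q) c)"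
  proof (intro mult_left_mono step)
    have "Q ^ Suc (card I) \<le> Q ^ k" using insert assms(4) by (intro power_increasing) auto
    then show "Q ^ card I * Q \<le> Q ^ k" by (simp add: mult.commute)
  qed (use assms in \<open>auto simp: one_le_power\<close>)
  also have "\<dots> = B ^ card (insert i I) * den_weight (Q ^ card (insert i I)) c"
    using insert by (simp add: mult_ac)
  finally show ?case .
qed

section \<open>Products of two fractions\<close>

lemma nat_abs_rnum_rden_unique:
  assumes "\<bar>x\<bar> = of_nat p / of_nat q" "q > 0" "coprime p q"
  shows "nat \<bar>rnum x\<bar> = p" "rden x = q"
proof -
  obtain s :: int where s: "x = of_int s / of_nat q" "\<bar>s\<bar> = int p"
  proof (cases "x \<ge> 0")
    case True
    then show ?thesis using assms by (intro that[of "int p"]) auto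
  next
    case False
    then have "x = - (of_nat p / of_nat q)" using assms by simp
    then show ?thesis by (intro that[of "- int p"]) auto
  qed
  have "coprime s (int q)"
    using assms(3) s(2) by (metis coprime_abs_left_iff coprime_int_iff)
  then show "nat \<bar>rnum x\<bar> = p" "rden x = q"
    using rnum_rden_unique[OF assms(2), of s] s by auto
qed

lemma abs_rat_eq: "\<bar>x\<bar> = of_nat (nat \<bar>rnum x\<bar>) / of_nat (rden x)"
  by (subst rat_eq_rnum_div_rden[of x]) (simp add: abs_divide)

text \<open>Cancelling \<open>e = gcd(num x, den y)\<close> and \<open>f = gcd(num y, den x)\<close> writes \<open>x = e x' / (f z)\<close>,
  \<open>y = f y' / (e z')\<close> with \<open>x y = x' y' / (z z')\<close> in lowest terms.\<close>

lemma product_in_lowest_terms: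
  fixes x y :: rat
  assumes "x * y \<noteq> 0"
  defines "e \<equiv> gcd (nat \<bar>rnum x\<bar>) (rden y)" and "f \<equiv> gcd (nat \<bar>rnum y\<bar>) (rden x)"
  obtains x' y' z z' where
    "nat \<bar>rnum x\<bar> = e * x'" "rden x = f * z" "nat \<bar>rnum y\<bar> = f * y'" "rden y = e * z'"
    "nat \<bar>rnum (x * y)\<bar> = x' * y'" "rden (x * y) = z * z'" "e > 0" "f > 0"
proof -
  define a b c d where "a = nat \<bar>rnum x\<bar>" and "b = rden x" and "c = nat \<bar>rnum y\<bar>" and "d = rden y"
  have cop: "coprime a b" "coprime c d"
    using coprime_rnum_rden[of x] coprime_rnum_rden[of y] unfolding a_def b_def c_def d_def
    by (metis coprime_abs_left_iff coprime_int_iff int_nat_eq abs_ge_zero)+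
  have pos: "b > 0" "d > 0" by (simp_all add: b_def d_def rden_pos)
  define x' y' z z' where "x' = a div e" and "y' = c div f" and "z = b div f" and "z' = d div e"
  have ef: "e > 0" "f > 0" using pos by (simp_all add: e_def f_def b_def d_def)
  have dvd: "e dvd a" "f dvd b" "f dvd c" "e dvd d" 
    unfolding e_def f_def a_def b_def c_def d_def by (rule gcd_dvd1 gcd_dvd2)+
  have eqs: "a = e * x'" "b = f * z" "c = f * y'" "d = e * z'"
    using dvd by (simp_all add: x'_def y'_def z_def z'_def)
  have "coprime x' z" "coprime y' z'"
    using cop unfolding eqs by (auto simp: coprime_mult_left_iff coprime_mult_right_iff)
  moreover have "coprime x' z'" 
    using pos unfolding x'_def z'_def e_def a_def[symmetric] d_def[symmetric] by (intro div_gcd_coprime) auto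
  moreover have "coprime y' z" 
    using pos unfolding y'_def z_def f_def b_def[symmetric] c_def[symmetric] by (intro div_gcd_coprime) auto
  ultimately have cop': "coprime (x' * y') (z * z')"
    by (simp add: coprime_mult_left_iff coprime_mult_right_iff)
  have zz: "z * z' > 0" using pos eqs by (metis mult_0_right gr0I mult_is_0)
  have "\<bar>x\<bar> = of_nat a / of_nat b" "\<bar>y\<bar> = of_nat c / of_nat d"
    using abs_rat_eq[of x] abs_rat_eq[of y] by (simp_all only: a_def b_def c_def d_def)
  then have "\<bar>x * y\<bar> = of_nat (x' * y') / of_nat (z * z')"
    using ef unfolding abs_mult eqs by simp
  from nat_abs_rnum_rden_unique[OF this zz cop'] show ?thesis
    using that[of x' z y' z'] eqs ef unfolding a_def b_def c_def d_def by blast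
qed

text \<open>Given the cancelled gcds \<open>e\<close>, \<open>f\<close>, the reduced numerator and
  denominator of \<open>x\<close> divide the numerator and denominator of \<open>w\<close>. So at
  most \<open>D\<^sup>2\<close> choices and a sign determine \<open>x\<close>, and then
  \<open>y = w / x\<close>. The constant 6 comes from the case \<open>w = 0\<close>.\<close>

lemma card_product_representations:
  assumes H: "H \<ge> 1" and D: "divisor_bound (H\<^sup>2) D"
  defines "F \<equiv> farey_rats H" and "N \<equiv> nat \<lfloor>H\<rfloor>"
  shows "real (card {(x, y) \<in> F \<times> F. x * y = w}) \<le>
    6 * D\<^sup>2 * card {(e, f) \<in> {1..N} \<times> {1..N}. w \<in> farey_rats (H\<^sup>2 / (real e * real f))}"
    (is "real (card ?S) \<le> 6 * D\<^sup>2 * card ?G")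
proof -
  have finG: "finite ?G" by (rule finite_subset[of _ "{1..N} \<times> {1..N}"]) auto
  have H2: "H\<^sup>2 \<ge> 1" using H by simp
  have D1: "D \<ge> 1" using divisor_bound_ge_1[OF D H2] .
  have finF: "finite F" by (simp add: F_def)
  have N_le: "real e \<le> H" if "e \<in> {1..N}" for e 
    using that unfolding N_def by (simp add: le_nat_floor nat_le_iff) linarith
  show ?thesis
  proof (cases "w = 0")
    case True
    \<comment> \<open>One factor vanishes, which leaves at most
      \<open>2 * card F \<le> 6 * N\<^sup>2\<close> pairs. On the other side \<open>?G\<close>
      consists of all \<open>N\<^sup>2\<close> pairs, since 0 lies in \<open>farey_rats h\<close>
      for every \<open>h \<ge> 1\<close>.\<close>
    have "?S \<subseteq> {0} \<times> F \<union> F \<times> {0}" using True by auto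
    then have "card ?S \<le> card ({0} \<times> F \<union> F \<times> {0})" using finF by (intro card_mono) auto
    also have "\<dots> \<le> card ({0 :: rat} \<times> F) + card (F \<times> {0 :: rat})" by (rule card_Un_le)
    also have "\<dots> \<le> 6 * N\<^sup>2"
      using card_farey_rats[OF H] by (simp add: card_cartesian_product F_def N_def)
    finally have "real (card ?S) \<le> real (6 * N\<^sup>2)" by (rule of_nat_mono)
    moreover have "?G = {1..N} \<times> {1..N}"
    proof -
      have "1 \<le> H\<^sup>2 / (real e * real f)" if "e \<in> {1..N}" "f \<in> {1..N}" for e f
        using that N_le[OF that(1)] N_le[OF that(2)] H 
        by (simp add: power2_eq_square field_simps mult_mono)
      then show ?thesis using True by (auto simp: farey_rats_iff)
    qed
    moreover have "1 \<le> D\<^sup>2" using D1 by simp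
    then have "6 * real N ^ 2 * 1 \<le> 6 * real N ^ 2 * D\<^sup>2" by (intro mult_left_mono) auto
    ultimately show ?thesis by (simp add: power2_eq_square mult_ac)
  next
    case False
    let ?n = "nat \<bar>rnum w\<bar>" and ?d = "rden w"
    define T where "T = ?G \<times> {d. d dvd ?n} \<times> {d. d dvd ?d} \<times> (UNIV :: bool set)"
    have n0: "?n > 0" using False rat_eq_rnum_div_rden[of w] by auto
    \<comment> \<open>The code of a representation: the two gcds, the reduced numerator and
      denominator of \<open>x\<close>, and the sign of \<open>x\<close>.\<close>
    define \<Phi> where "\<Phi> = (\<lambda>(x, y). 
       let e = gcd (nat \<bar>rnum x\<bar>) (rden y); f = gcd (nat \<bar>rnum y\<bar>) (rden x)
       in ((e, f), nat \<bar>rnum x\<bar> div e, rden x div f, x > 0))"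
    have "\<Phi> ` ?S \<subseteq> T"
    proof
      fix t assume "t \<in> \<Phi> ` ?S"
      then obtain x y where xy: "x \<in> F" "y \<in> F" "x * y = w" "t = \<Phi> (x, y)" by auto
      define e f where "e = gcd (nat \<bar>rnum x\<bar>) (rden y)" and "f = gcd (nat \<bar>rnum y\<bar>) (rden x)"
      have nz: "x * y \<noteq> 0" using xy(3) False by simp
      obtain x' y' z z' where *: "nat \<bar>rnum x\<bar> = e * x'" "rden x = f * z" "nat \<bar>rnum y\<bar> = f * y'" "rden y = e * z'"
        "?n = x' * y'" "?d = z * z'" "e > 0" "f > 0"
        by (rule product_in_lowest_terms[OF nz, folded e_def f_def, unfolded xy(3)])
      have t: "t = ((e, f), x', z, x > 0)"
      proof -
        have "\<Phi> (x, y) = ((e, f), nat \<bar>rnum x\<bar> div e, rden x div f, x > 0)"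
          unfolding \<Phi>_def Let_def prod.case e_def f_def ..
        then show ?thesis using xy(4) * by simp
      qed
      have le: "real (e * x') \<le> H" "real (f * z) \<le> H" "real (f * y') \<le> H" "real (e * z') \<le> H"
        using xy(1,2) unfolding F_def farey_rats_iff *(1-4)[symmetric] by auto
      have pos: "x' > 0" "y' > 0" "z > 0" "z' > 0" 
        using n0 *(5,6) rden_pos[of w] by (metis mult_is_0 gr0I)+
      have "e \<le> N" "f \<le> N"
      proof -
        have "real e \<le> real (e * z')" "real f \<le> real (f * z)" 
          using pos by (intro of_nat_mono; simp)+
        then show "e \<le> N" "f \<le> N" using le unfolding N_def by (auto simp: le_nat_floor)
      qed
      moreover have "real (x' * y') \<le> H\<^sup>2 / (real e * real f)" "real (z * z') \<le> H\<^sup>2 / (real e * real f)"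
      proof -
        have "real (e * x') * real (f * y') \<le> H * H" "real (e * z') * real (f * z) \<le> H * H"
          using le H by (intro mult_mono; simp)+
        then show "real (x' * y') \<le> H\<^sup>2 / (real e * real f)" "real (z * z') \<le> H\<^sup>2 / (real e * real f)"
          using *(7,8) by (simp_all add: power2_eq_square field_simps)
      qed
      then have "w \<in> farey_rats (H\<^sup>2 / (real e * real f))"
        unfolding farey_rats_iff *(5,6)[symmetric] by simp
      ultimately show "t \<in> T" using *(5-8) unfolding t T_def by auto
    qed
    moreover have "inj_on \<Phi> ?S"
    proof (rule inj_onI)
      fix s t assume st: "s \<in> ?S" "t \<in> ?S" "\<Phi> s = \<Phi> t"
      obtain x y u v where [simp]: "s = (x, y)" "t = (u, v)" by (cases s, cases t)
      have xy: "x * y = w" "u * v = w" using st by auto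
      define e f where "e = gcd (nat \<bar>rnum x\<bar>) (rden y)" and "f = gcd (nat \<bar>rnum y\<bar>) (rden x)"
      have *: "gcd (nat \<bar>rnum u\<bar>) (rden v) = e" "gcd (nat \<bar>rnum v\<bar>) (rden u) = f"
        "nat \<bar>rnum u\<bar> div e = nat \<bar>rnum x\<bar> div e" "rden u div f = rden x div f" "(u > 0) = (x > 0)"
      proof -
        have a: "\<Phi> s = ((e, f), nat \<bar>rnum x\<bar> div e, rden x div f, x > 0)"
          unfolding \<Phi>_def Let_def e_def f_def by simp
        have b: "\<Phi> t = ((gcd (nat \<bar>rnum u\<bar>) (rden v), gcd (nat \<bar>rnum v\<bar>) (rden u)),
            nat \<bar>rnum u\<bar> div gcd (nat \<bar>rnum u\<bar>) (rden v), rden u div gcd (nat \<bar>rnum v\<bar>) (rden u), u > 0)"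
          unfolding \<Phi>_def Let_def by simp
        have *: "gcd (nat \<bar>rnum u\<bar>) (rden v) = e \<and> gcd (nat \<bar>rnum v\<bar>) (rden u) = f \<and>
            nat \<bar>rnum u\<bar> div gcd (nat \<bar>rnum u\<bar>) (rden v) = nat \<bar>rnum x\<bar> div e \<and> 
            rden u div gcd (nat \<bar>rnum v\<bar>) (rden u) = rden x div f \<and> (u > 0) = (x > 0)"
          using st(3)[symmetric, unfolded a b prod.inject] by (elim conjE, intro conjI)
        note c = conjunct1[OF *] conjunct2[OF *]
        note d = conjunct1[OF c(2)] conjunct2[OF c(2)]
        note e' = conjunct1[OF d(2)] conjunct2[OF d(2)]
        show "gcd (nat \<bar>rnum u\<bar>) (rden v) = e" by (rule c(1))
        show "gcd (nat \<bar>rnum v\<bar>) (rden u) = f" by (rule d(1))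
        show "(u > 0) = (x > 0)" by (rule conjunct2[OF e'(2)])
        show "nat \<bar>rnum u\<bar> div e = nat \<bar>rnum x\<bar> div e" by (rule e'(1)[unfolded c(1)])
        show "rden u div f = rden x div f" by (rule conjunct1[OF e'(2), unfolded d(1)])
      qed
      have dvds: "e dvd nat \<bar>rnum u\<bar>" "e dvd nat \<bar>rnum x\<bar>" "f dvd rden u" "f dvd rden x"
        using gcd_dvd1[of "nat \<bar>rnum u\<bar>" "rden v"] gcd_dvd2[of "nat \<bar>rnum v\<bar>" "rden u"]
        unfolding *(1,2) by (simp_all only: e_def f_def gcd_dvd1 gcd_dvd2)
      have "nat \<bar>rnum u\<bar> = nat \<bar>rnum x\<bar>" "rden u = rden x"
        using dvds *(3,4) by (metis dvd_mult_div_cancel)+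
      then have "\<bar>u\<bar> = \<bar>x\<bar>" using abs_rat_eq[of u] abs_rat_eq[of x] by simp
      then have "u = x" using *(5) xy False by (auto simp: abs_if split: if_splits)
      then show "s = t" using xy False by auto
    qed
    moreover have "finite T" unfolding T_def using finG n0 rden_pos[of w]
      by (intro finite_cartesian_product finite_divisors_nat) simp_all
    ultimately have "card ?S \<le> card T" by - (rule card_inj_on_le)
    then have "real (card ?S) \<le> real (card T)" by (rule of_nat_mono)
    also have "\<dots> = card ?G * (real (card {d. d dvd ?n}) * (real (card {d. d dvd ?d}) * 2))"
      unfolding T_def card_cartesian_product by (simp add: card_UNIV_bool)
    \<comment> \<open>If \<open>?G\<close> is nonempty, then \<open>w\<close> has height at most
      \<open>H\<^sup>2\<close>, which is the range of the divisor bound; otherwise both sides are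
      0.\<close>
    also have "\<dots> \<le> 6 * D\<^sup>2 * card ?G"
    proof (cases "?G = {}")
      case nonempty: False
      then obtain e f where ef: "e \<in> {1..N}" "f \<in> {1..N}" "w \<in> farey_rats (H\<^sup>2 / (real e * real f))" by auto
      have "1 * 1 \<le> real e * real f" using ef by (intro mult_mono) auto
      then have "H\<^sup>2 / (real e * real f) \<le> H\<^sup>2" 
        using H2 by (simp add: divide_le_eq mult_le_cancel_left1)
      then have "real ?n \<le> H\<^sup>2" "real ?d \<le> H\<^sup>2" using ef(3) by (auto simp: farey_rats_iff)
      then have "real (card {d. d dvd ?n}) \<le> D" "real (card {d. d dvd ?d}) \<le> D"
        using n0 rden_pos[of w] by - (rule divisor_boundD[OF D]; assumption)+
      then have "real (card {d. d dvd ?n}) * (real (card {d. d dvd ?d}) * 2) \<le> D * (D * 2)"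
        using D1 by (intro mult_mono) auto
      also have "\<dots> \<le> 6 * D\<^sup>2" by (simp add: power2_eq_square)
      finally show ?thesis unfolding mult.commute[of "real (card ?G)"] by (rule mult_right_mono) simp
    next
      case empty: True
      show ?thesis unfolding empty by (simp only: card.empty of_nat_0 mult_zero_left mult_zero_right order_refl)
    qed
    finally show ?thesis .
  qed
qed

section \<open>Sums over products of two fractions\<close>

text \<open>Grouping the pairs by their product \<open>w\<close> and exchanging sums replaces
  products by single fractions of height at most \<open>H\<^sup>2 / (e * f)\<close>, to which the
  estimates for one fraction apply.\<close>

lemma sum_over_products_le:
  fixes \<phi> :: "rat \<Rightarrow> real"
  assumes H: "H \<ge> 1" and D: "divisor_bound (H\<^sup>2) D" and nonneg: "\<And>w. \<phi> w \<ge> 0"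
  shows "(\<Sum>(x, y) \<in> farey_rats H \<times> farey_rats H. \<phi> (x * y)) \<le>
    6 * D\<^sup>2 * (\<Sum>(e, f) \<in> {1..nat \<lfloor>H\<rfloor>} \<times> {1..nat \<lfloor>H\<rfloor>}. \<Sum>w \<in> farey_rats (H\<^sup>2 / (real e * real f)). \<phi> w)"
proof -
  let ?F = "farey_rats H \<times> farey_rats H" and ?N = "{1..nat \<lfloor>H\<rfloor>} \<times> {1..nat \<lfloor>H\<rfloor>}"
  define W where "W = (\<lambda>(x, y). x * y) ` ?F"
  define h where "h = (\<lambda>(e, f). H\<^sup>2 / (real e * real f))"
  have finW: "finite W" by (simp add: W_def)
  have reps: "real (card {z \<in> ?F. fst z * snd z = w}) \<le> 6 * D\<^sup>2 * card {ef \<in> ?N. w \<in> farey_rats (h ef)}" for w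
  proof -
    have "{z \<in> ?F. fst z * snd z = w} = {(x, y) \<in> ?F. x * y = w}"
      "{ef \<in> ?N. w \<in> farey_rats (h ef)} = {(e, f) \<in> ?N. w \<in> farey_rats (H\<^sup>2 / (real e * real f))}"
      by (auto simp: h_def)
    then show ?thesis using card_product_representations[OF H D, of w] by simp
  qed
  have "(\<Sum>z\<in>?F. \<phi> (fst z * snd z)) = (\<Sum>w\<in>W. \<Sum>z | z \<in> ?F \<and> fst z * snd z = w. \<phi> (fst z * snd z))"
    unfolding W_def case_prod_unfold by (rule sum.image_gen) auto
  also have "\<dots> = (\<Sum>w\<in>W. real (card {z \<in> ?F. fst z * snd z = w}) * \<phi> w)"
    by (intro sum.cong) auto
  also have "\<dots> \<le> (\<Sum>w\<in>W. 6 * D\<^sup>2 * card {ef \<in> ?N. w \<in> farey_rats (h ef)} * \<phi> w)"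
    using reps nonneg by (intro sum_mono mult_right_mono)
  also have "\<dots> = (\<Sum>w\<in>W. 6 * D\<^sup>2 * (\<Sum>ef\<in>?N. if w \<in> farey_rats (h ef) then \<phi> w else 0))"
    by (intro sum.cong) (auto simp: sum.If_cases Int_def)
  also have "\<dots> = 6 * D\<^sup>2 * (\<Sum>ef\<in>?N. \<Sum>w\<in>W. if w \<in> farey_rats (h ef) then \<phi> w else 0)"
    by (subst sum.swap) (simp add: sum_distrib_left)
  also have "\<dots> = 6 * D\<^sup>2 * (\<Sum>ef\<in>?N. \<Sum>w\<in>W \<inter> farey_rats (h ef). \<phi> w)"
    using finW by (simp add: sum.inter_restrict)
  also have "\<dots> \<le> 6 * D\<^sup>2 * (\<Sum>ef\<in>?N. \<Sum>w\<in>farey_rats (h ef). \<phi> w)"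
    using nonneg by (intro mult_left_mono sum_mono sum_mono2) auto
  finally show ?thesis by (simp add: case_prod_unfold h_def)
qed

lemma gcd_range_hyperbola:
  assumes "H \<ge> 1" "e \<in> {1..nat \<lfloor>H\<rfloor>}" "f \<in> {1..nat \<lfloor>H\<rfloor>}"
  shows "1 \<le> H\<^sup>2 / (real e * real f)" "H\<^sup>2 / (real e * real f) \<le> H\<^sup>2"
proof -
  have le: "real e \<le> H" "real f \<le> H" and ge: "1 \<le> real e" "1 \<le> real f"
    using assms by (auto simp: le_nat_iff le_floor_iff)
  have "real e * real f \<le> H * H" using le assms by (intro mult_mono) auto
  moreover have ef: "1 * 1 \<le> real e * real f" using ge by (intro mult_mono) auto
  ultimately show "1 \<le> H\<^sup>2 / (real e * real f)" by (simp add: power2_eq_square)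
  have "H\<^sup>2 * 1 \<le> H\<^sup>2 * (real e * real f)" using ef by (intro mult_left_mono) auto
  then show "H\<^sup>2 / (real e * real f) \<le> H\<^sup>2" using ef by (simp add: divide_le_eq)
qed

text \<open>The double sum is \<open>H\<^sup>2\<close> times the square of a harmonic sum: summing
  over the cancelled gcds costs only logarithms.\<close>

lemma sum_hyperbola_le:
  assumes H: "H \<ge> 1"
  shows "(\<Sum>(e, f) \<in> {1..nat \<lfloor>H\<rfloor>} \<times> {1..nat \<lfloor>H\<rfloor>}. H\<^sup>2 / (real e * real f)) \<le> H\<^sup>2 * (1 + ln H)\<^sup>2"
proof -
  let ?s = "\<Sum>j = 1..nat \<lfloor>H\<rfloor>. 1 / real j"
  have "(\<Sum>(e, f) \<in> {1..nat \<lfloor>H\<rfloor>} \<times> {1..nat \<lfloor>H\<rfloor>}. H\<^sup>2 / (real e * real f)) = H\<^sup>2 * (?s * ?s)"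
  proof -
    have "?s * ?s = (\<Sum>(e, f) \<in> {1..nat \<lfloor>H\<rfloor>} \<times> {1..nat \<lfloor>H\<rfloor>}. 1 / (real e * real f))"
      unfolding sum_product sum.cartesian_product by simp
    then show ?thesis by (simp add: sum_distrib_left case_prod_unfold)
  qed
  also have "\<dots> \<le> H\<^sup>2 * ((1 + ln H) * (1 + ln H))"
    using sum_inverse_le_ln[OF H] H by (intro mult_left_mono mult_mono) (auto intro!: sum_nonneg)
  finally show ?thesis by (simp add: power2_eq_square)
qed

text \<open>For each \<open>(e, f)\<close> the convolution with fractions of height
  \<open>h = H\<^sup>2 / (e * f)\<close> costs about \<open>h\<close>, and these costs add up to
  about \<open>H\<^sup>2\<close>. As \<open>h \<le> H\<^sup>2\<close>, divisor bounds up to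
  \<open>R * H ^ 4\<close> suffice.\<close>

lemma sum_den_weight_products:
  assumes H: "H \<ge> 1" and R: "R \<ge> 1" and D: "divisor_bound (R * H ^ 4) D"
  shows "(\<Sum>(x, y) \<in> farey_rats H \<times> farey_rats H. den_weight R (c - x * y)) \<le>
    36 * D ^ 4 * (1 + ln H) ^ 3 * H\<^sup>2 * den_weight (R * H\<^sup>2) c"
proof -
  let ?N = "{1..nat \<lfloor>H\<rfloor>} \<times> {1..nat \<lfloor>H\<rfloor>}"
  have H2: "1 \<le> H\<^sup>2" using H by simp
  have lnH: "ln H \<ge> 0" using H by simp
  have R4: "H\<^sup>2 * H\<^sup>2 \<le> R * H ^ 4" using R H
    by (simp add: mult_le_cancel_right1 flip: power_add)
  have "1 * 1 \<le> H\<^sup>2 * H\<^sup>2" using H2 by (intro mult_mono) auto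
  then have D1: "D \<ge> 1" using divisor_bound_ge_1[OF D] R4 by linarith
  have "H\<^sup>2 * 1 \<le> H\<^sup>2 * H\<^sup>2" using H2 by (intro mult_left_mono) auto
  then have D2: "divisor_bound (H\<^sup>2) D" using divisor_bound_mono[OF D] R4 by simp
  have inner: "(\<Sum>w \<in> farey_rats h. den_weight R (c - w)) \<le> 
      6 * D\<^sup>2 * (1 + ln H) * den_weight (R * H\<^sup>2) c * h" if h: "1 \<le> h" "h \<le> H\<^sup>2" for h
  proof -
    have "h * h \<le> H\<^sup>2 * H\<^sup>2" using h by (intro mult_mono) auto
    then have "R * (h * h) \<le> R * (H\<^sup>2 * H\<^sup>2)" using R by (intro mult_left_mono) auto
    then have "divisor_bound (R * h * h) D" 
      by (intro divisor_bound_mono[OF D]) (simp add: mult.assoc flip: power_add)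
    then have "(\<Sum>w \<in> farey_rats h. den_weight R (c - w)) \<le> 3 * D\<^sup>2 * (1 + ln h) * h * den_weight (R * h) c"
      by (rule sum_den_weight_farey_rats[OF h(1) R])
    also have "\<dots> \<le> 3 * D\<^sup>2 * (2 * (1 + ln H)) * h * den_weight (R * H\<^sup>2) c"
    proof (intro mult_mono den_weight_mono mult_left_mono)
      have "ln h \<le> ln (H\<^sup>2)" using h by (intro ln_mono) auto
      also have "\<dots> = 2 * ln H" using H by (simp add: ln_realpow)
      finally show "1 + ln h \<le> 2 * (1 + ln H)" by simp
    qed (use h R H lnH in auto)
    finally show ?thesis by (simp add: algebra_simps)
  qed
  have "(\<Sum>(x, y) \<in> farey_rats H \<times> farey_rats H. den_weight R (c - x * y)) \<le> 
     6 * D\<^sup>2 * (\<Sum>(e, f) \<in> ?N. \<Sum>w \<in> farey_rats (H\<^sup>2 / (real e * real f)). den_weight R (c - w))"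
    by (rule sum_over_products_le[OF H D2]) simp
  also have "\<dots> \<le> 6 * D\<^sup>2 * (\<Sum>(e, f) \<in> ?N. 
      6 * D\<^sup>2 * (1 + ln H) * den_weight (R * H\<^sup>2) c * (H\<^sup>2 / (real e * real f)))"
  proof (intro mult_left_mono sum_mono)
    fix ef assume "ef \<in> ?N"
    then obtain e f where ef: "ef = (e, f)" "e \<in> {1..nat \<lfloor>H\<rfloor>}" "f \<in> {1..nat \<lfloor>H\<rfloor>}" by blast
    show "(case ef of (e, f) \<Rightarrow> \<Sum>w \<in> farey_rats (H\<^sup>2 / (real e * real f)). den_weight R (c - w)) \<le>
      (case ef of (e, f) \<Rightarrow> 6 * D\<^sup>2 * (1 + ln H) * den_weight (R * H\<^sup>2) c * (H\<^sup>2 / (real e * real f)))"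
      using inner[OF gcd_range_hyperbola[OF H ef(2,3)]] unfolding ef(1) prod.case .
  qed simp
  also have "\<dots> = 36 * D ^ 4 * (1 + ln H) * den_weight (R * H\<^sup>2) c * (\<Sum>(e, f) \<in> ?N. H\<^sup>2 / (real e * real f))"
    by (simp add: case_prod_unfold sum_distrib_left power2_eq_square power4_eq_xxxx mult_ac)
  also have "\<dots> \<le> 36 * D ^ 4 * (1 + ln H) * den_weight (R * H\<^sup>2) c * (H\<^sup>2 * (1 + ln H)\<^sup>2)"
    using sum_hyperbola_le[OF H] lnH by (intro mult_left_mono) auto
  finally show ?thesis by (simp only: power2_eq_square power3_eq_cube mult_ac)
qed

section \<open>Traces and the characteristic polynomial\<close>

lemma index_mult_mat_sum:
  assumes "A \<in> carrier_mat n m" "B \<in> carrier_mat m l" "i < n" "j < l"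
  shows "(A * B) $$ (i, j) = (\<Sum>k<m. A $$ (i, k) * B $$ (k, j))"
  using assms by (simp add: scalar_prod_def atLeast0LessThan)

lemma trace_mult_commute:
  fixes A B :: "'a :: comm_semiring_0 mat"
  assumes "A \<in> carrier_mat n m" "B \<in> carrier_mat m n"
  shows "(\<Sum>i<n. (A * B) $$ (i, i)) = (\<Sum>j<m. (B * A) $$ (j, j))"
proof -
  have "(\<Sum>i<n. (A * B) $$ (i, i)) = (\<Sum>i<n. \<Sum>k<m. A $$ (i, k) * B $$ (k, i))"
    using assms by (intro sum.cong refl) (simp add: index_mult_mat_sum del: index_mult_mat)
  also have "\<dots> = (\<Sum>k<m. \<Sum>i<n. B $$ (k, i) * A $$ (i, k))"
    by (subst sum.swap) (simp add: mult.commute)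
  also have "\<dots> = (\<Sum>j<m. (B * A) $$ (j, j))"
    using assms by (intro sum.cong refl) (simp add: index_mult_mat_sum del: index_mult_mat)
  finally show ?thesis .
qed

lemma trace_similar:
  fixes A B :: "'a :: comm_ring_1 mat"
  assumes "A \<in> carrier_mat n n" "similar_mat_wit A B P Q"
  shows "(\<Sum>i<n. A $$ (i, i)) = (\<Sum>i<n. B $$ (i, i))"
proof -
  note w = similar_mat_witD2[OF assms]
  have "(\<Sum>i<n. A $$ (i, i)) = (\<Sum>i<n. (P * B * Q) $$ (i, i))" using w by simp
  also have "\<dots> = (\<Sum>i<n. (Q * (P * B)) $$ (i, i))" using w by (intro trace_mult_commute[of _ n n]) auto
  also have "Q * (P * B) = (Q * P) * B" using w by (intro assoc_mult_mat[symmetric]) auto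
  also have "\<dots> = B" using w by simp
  finally show ?thesis .
qed

text \<open>By Schur, \<open>A\<close> is similar to an upper triangular \<open>B\<close> with
  diagonal \<open>es\<close>, the same witnesses relate \<open>A * A\<close> to
  \<open>B * B\<close>, and traces are invariant under similarity.\<close>

lemma traces_eq_power_sums_of_roots:
  fixes A :: "complex mat"
  assumes A: "A \<in> carrier_mat n n" and es: "char_poly A = (\<Prod>e\<leftarrow>es. [:- e, 1:])"
  shows "(\<Sum>i<n. A $$ (i, i)) = sum_list es"
    and "(\<Sum>i<n. (A * A) $$ (i, i)) = (\<Sum>e\<leftarrow>es. e\<^sup>2)"
proof -
  obtain B P Q where schur: "schur_decomposition A es = (B, P, Q)" by (cases "schur_decomposition A es") auto
  note sd = schur_decomposition[OF A es schur]
  then have wit: "similar_mat_wit A B P Q" and ut: "upper_triangular B" and diag: "diag_mat B = es" by auto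
  have B: "B \<in> carrier_mat n n" using similar_mat_witD2[OF A wit] by auto
  have es': "es = map (\<lambda>i. B $$ (i, i)) [0..<n]" using diag B by (auto simp: diag_mat_def)
  show "(\<Sum>i<n. A $$ (i, i)) = sum_list es"
    unfolding trace_similar[OF A wit] es' by (simp add: interv_sum_list_conv_sum_set_nat atLeast0LessThan)
  have wit2: "similar_mat_wit (A * A) (B * B) P Q"
    using similar_mat_wit_pow[OF wit, of 2] A B by (simp add: numeral_2_eq_2)
  have "(\<Sum>i<n. (A * A) $$ (i, i)) = (\<Sum>i<n. (B * B) $$ (i, i))"
    using A by (intro trace_similar[OF _ wit2]) auto
  also have "\<dots> = (\<Sum>i<n. (B $$ (i, i))\<^sup>2)"
  proof (rule sum.cong)
    fix i assume i: "i \<in> {..<n}"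
    have "(B * B) $$ (i, i) = (\<Sum>k<n. B $$ (i, k) * B $$ (k, i))" using B i by (intro index_mult_mat_sum) auto
    \<comment> \<open>For \<open>k \<noteq> i\<close> one of the entries \<open>(i, k)\<close> and
      \<open>(k, i)\<close> lies below the diagonal and vanishes.\<close>
    also have "\<dots> = (\<Sum>k<n. if k = i then (B $$ (i, i))\<^sup>2 else 0)"
    proof (intro sum.cong refl)
      fix k assume "k \<in> {..<n}"
      then show "B $$ (i, k) * B $$ (k, i) = (if k = i then (B $$ (i, i))\<^sup>2 else 0)"
        using upper_triangularD[OF ut, of i k] upper_triangularD[OF ut, of k i] B i by (cases k i rule: linorder_cases) (auto simp: power2_eq_square)
    qed
    finally show "(B * B) $$ (i, i) = (B $$ (i, i))\<^sup>2" using i by simp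
  qed simp
  also have "\<dots> = (\<Sum>e\<leftarrow>es. e\<^sup>2)"
    unfolding es' by (simp add: interv_sum_list_conv_sum_set_nat atLeast0LessThan o_def)
  finally show "(\<Sum>i<n. (A * A) $$ (i, i)) = (\<Sum>e\<leftarrow>es. e\<^sup>2)" .
qed

text \<open>The characteristic polynomial may fail to split over the rationals, so both matrices are
  mapped to complex ones, which share the root list \<open>es\<close>; injectivity of
  \<open>of_rat\<close> brings the equalities back.\<close>

lemma char_poly_eq_imp_traces_eq:
  fixes A B :: "rat mat"
  assumes A: "A \<in> carrier_mat n n" and B: "B \<in> carrier_mat n n" and eq: "char_poly A = char_poly B"
  shows "(\<Sum>i<n. A $$ (i, i)) = (\<Sum>i<n. B $$ (i, i))"
    and "(\<Sum>i<n. \<Sum>j<n. A $$ (i, j) * A $$ (j, i)) = (\<Sum>i<n. \<Sum>j<n. B $$ (i, j) * B $$ (j, i))"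
proof -
  let ?c = "map_mat (of_rat :: rat \<Rightarrow> complex)"
  have cA: "?c A \<in> carrier_mat n n" and cB: "?c B \<in> carrier_mat n n" using A B by auto
  obtain es where es: "char_poly (?c A) = (\<Prod>e\<leftarrow>es. [:- e, 1:])" using char_poly_factorized[OF cA] by blast
  have es': "char_poly (?c B) = (\<Prod>e\<leftarrow>es. [:- e, 1:])"
    using es unfolding of_rat_hom.char_poly_hom[OF A] of_rat_hom.char_poly_hom[OF B] eq .
  have tr: "(\<Sum>i<n. ?c M $$ (i, i)) = of_rat (\<Sum>i<n. M $$ (i, i))" if "M \<in> carrier_mat n n" for M
    using that by (simp add: of_rat_sum)
  have tr2: "(\<Sum>i<n. (?c M * ?c M) $$ (i, i)) = of_rat (\<Sum>i<n. \<Sum>j<n. M $$ (i, j) * M $$ (j, i))" 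
    if M: "M \<in> carrier_mat n n" for M
  proof -
    have "(?c M * ?c M) $$ (i, i) = of_rat (\<Sum>j<n. M $$ (i, j) * M $$ (j, i))" if "i < n" for i
      using M that index_mult_mat_sum[of "?c M" n n "?c M" n i i] 
      by (simp add: of_rat_sum of_rat_mult del: index_mult_mat)
    then show ?thesis by (simp add: of_rat_sum del: index_mult_mat)
  qed
  show "(\<Sum>i<n. A $$ (i, i)) = (\<Sum>i<n. B $$ (i, i))"
    using traces_eq_power_sums_of_roots(1)[OF cA es, folded traces_eq_power_sums_of_roots(1)[OF cB es']]
    unfolding tr[OF A] tr[OF B] of_rat_eq_iff .
  show "(\<Sum>i<n. \<Sum>j<n. A $$ (i, j) * A $$ (j, i)) = (\<Sum>i<n. \<Sum>j<n. B $$ (i, j) * B $$ (j, i))"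
    using traces_eq_power_sums_of_roots(2)[OF cA es, folded traces_eq_power_sums_of_roots(2)[OF cB es']]
    unfolding tr2[OF A] tr2[OF B] of_rat_eq_iff .
qed

section \<open>Values of a quadratic polynomial\<close>

lemma card_le_sum_fibers:
  assumes "finite A" "finite B" "f ` A \<subseteq> B" "\<And>b. b \<in> B \<Longrightarrow> real (card {a \<in> A. f a = b}) \<le> K b"
  shows "real (card A) \<le> (\<Sum>b\<in>B. K b)"
proof -
  have "real (card A) = (\<Sum>b\<in>B. \<Sum>a | a \<in> A \<and> f a = b. 1)"
    unfolding sum.group[OF assms(1-3)] by simp
  also have "\<dots> = (\<Sum>b\<in>B. real (card {a \<in> A. f a = b}))" by simp
  also have "\<dots> \<le> (\<Sum>b\<in>B. K b)" using assms(4) by (rule sum_mono)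
  finally show ?thesis .
qed

text \<open>The rational root theorem for \<open>l * X\<^sup>2 - n * X - m\<close>: the denominator
  of a root divides the leading coefficient.\<close>

lemma rden_dvd_of_quadratic_root:
  fixes a :: rat
  assumes "of_nat l * a\<^sup>2 = of_int n * a + of_int m"
  shows "rden a dvd l"
proof -
  define p q where "p = rnum a" and "q = int (rden a)"
  have q: "q > 0" by (simp add: q_def rden_pos)
  have a: "a * of_int q = of_int p"
    using rat_eq_rnum_div_rden[of a] q by (simp add: p_def q_def field_simps)
  have "(of_int (int l * p\<^sup>2) :: rat) = of_nat l * a\<^sup>2 * (of_int q)\<^sup>2"
    by (simp add: power_mult_distrib flip: a)
  also have "\<dots> = of_int (q * (n * p + m * q))"
    unfolding assms by (simp add: algebra_simps power2_eq_square flip: a)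
  finally have "int l * p\<^sup>2 = q * (n * p + m * q)" by (simp only: of_int_eq_iff)
  then have "q dvd int l * p\<^sup>2" by simp
  moreover have "coprime q (p\<^sup>2)"
    using coprime_rnum_rden[of a] by (simp add: p_def q_def coprime_commute)
  ultimately have "q dvd int l" by (simp add: coprime_dvd_mult_left_iff)
  then show ?thesis by (simp add: q_def)
qed

text \<open>The gcd \<open>g\<close> of the two denominators is coprime to both numerators, so
  clearing denominators gives \<open>g * g dvd z\<close>, which forces \<open>g\<close> to be a
  unit.\<close>

lemma coprime_rden_if_squarefree_mult_Ints:
  fixes x y :: rat
  assumes "squarefree z" "of_nat z * (x * y) \<in> \<int>"
  shows "coprime (rden x) (rden y)"
proof -
  define g where "g = int (gcd (rden x) (rden y))"
  obtain k where "of_nat z * (x * y) = of_int k" using assms(2) by (auto elim: Ints_cases)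
  then have "of_int k = of_nat z * ((of_int (rnum x) / of_nat (rden x)) * (of_int (rnum y) / of_nat (rden y)) :: rat)"
    using rat_eq_rnum_div_rden[of x] rat_eq_rnum_div_rden[of y] by simp
  then have "(of_int (k * (int (rden x) * int (rden y))) :: rat) = of_int (int z * (rnum x * rnum y))"
    using rden_pos[of x] rden_pos[of y] by (simp add: field_simps)
  then have eq: "k * (int (rden x) * int (rden y)) = int z * (rnum x * rnum y)" by (simp only: of_int_eq_iff)
  have g: "g dvd int (rden x)" "g dvd int (rden y)" by (simp_all add: g_def)
  then have "g * g dvd int (rden x) * int (rden y)" by (rule mult_dvd_mono)
  then have "g * g dvd int z * (rnum x * rnum y)" using eq by (metis dvd_mult)
  moreover have "coprime (g * g) (rnum x * rnum y)"
  proof -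
    have "coprime g (rnum x)" "coprime g (rnum y)"
      using g coprime_rnum_rden[of x] coprime_rnum_rden[of y] 
      by (meson coprime_commute coprime_divisors dvd_refl)+
    then show ?thesis by simp
  qed
  ultimately have "g * g dvd int z" by (simp add: coprime_dvd_mult_left_iff)
  then have "(gcd (rden x) (rden y))\<^sup>2 dvd z" 
    unfolding g_def power2_eq_square by (metis int_dvd_int_iff of_nat_mult)
  then have "is_unit (gcd (rden x) (rden y))" using assms(1) squarefreeD by blast
  then show ?thesis by (simp add: coprime_iff_gcd_eq_1)
qed

lemma of_nat_rden_mult: "of_nat (rden x) * x = of_int (rnum x)"
  using rat_eq_rnum_div_rden[of x] rden_pos[of x] by (simp add: field_simps)

text \<open>Two solutions \<open>a, b\<close> satisfy \<open>(a - b) (a + b - t) = r(b) - r(a)\<close>. If \<open>r(a)\<close> and \<open>r(b)\<close>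
  have denominator \<open>M\<^sup>2 z\<close> with \<open>z\<close> squarefree, then \<open>M (a - b)\<close> and \<open>M (a + b - t)\<close> have
  coprime denominators. So after sorting the solutions by the denominator of \<open>M (a - a0)\<close> and by
  the sign of \<open>2 a - t\<close>, the differences \<open>M (a - b)\<close> within a class are integers of size at most
  \<open>sqrt (2 h / z)\<close>.\<close>

lemma card_quadratic_values_fixed_den:
  fixes t c :: rat and M z :: nat
  defines "r \<equiv> \<lambda>a. a * (t - a) - c"
  assumes fin: "finite A" and z: "squarefree z" "z > 0" "M > 0" "real z \<le> h"
    and rA: "\<And>a. a \<in> A \<Longrightarrow> r a \<in> farey_rats h \<and> rden (r a) = M\<^sup>2 * z"
    and D: "real (card {d. d dvd M\<^sup>2 * z * rden t * rden c}) \<le> D"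
  shows "real (card A) \<le> 6 * D * sqrt (h / z)"
proof (cases "A = {}")
  case True
  then show ?thesis using D z by (simp add: order_trans[OF of_nat_0_le_iff D])
next
  case False
  then obtain a0 where a0: "a0 \<in> A" by blast
  define L where "L = M\<^sup>2 * z * rden t * rden c"
  define w w' where "w = (\<lambda>a. of_nat M * (a - a0))" and "w' = (\<lambda>a. of_nat M * (a + a0 - t))"
  define cls where "cls = (\<lambda>a. (rden (w a), 2 * a \<ge> t))"
  have L0: "L > 0" using z rden_pos[of t] rden_pos[of c] by (simp add: L_def)
  \<comment> \<open>\<open>a\<close> satisfies \<open>a\<^sup>2 = t * a - (c + r a)\<close>, and
    \<open>L\<close> clears the denominators of both coefficients.\<close>
  have den_dvd_L: "rden a dvd L" if "a \<in> A" for a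
  proof -
    have "rden t dvd L" "rden c dvd L" by (simp_all add: L_def)
    moreover have "rden (r a) dvd L" using rA[OF that] by (simp add: L_def mult.assoc)
    ultimately have "of_nat L * t \<in> \<int>" "of_nat L * (c + r a) \<in> \<int>"
      by (simp_all add: rden_dvd_iff distrib_left)
    then obtain n m where "of_nat L * t = of_int n" "of_nat L * (c + r a) = of_int m"
      by (auto elim!: Ints_cases)
    moreover have "of_nat L * a\<^sup>2 = (of_nat L * t) * a - of_nat L * (c + r a)"
      by (simp add: r_def power2_eq_square algebra_simps)
    ultimately show ?thesis using rden_dvd_of_quadratic_root[of L a n "- m"] by simp
  qed
  \<comment> \<open>The factorisation \<open>r b - r a = (a - b) * (a + b - t)\<close>, multiplied
    by the common denominator \<open>M\<^sup>2 * z\<close>.\<close>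
  have diff: "of_nat M * (a - b) * (of_nat M * (a + b - t)) * of_nat z = of_int (rnum (r b) - rnum (r a))"
    if "a \<in> A" "b \<in> A" for a b
  proof -
    have "of_nat M * (a - b) * (of_nat M * (a + b - t)) * of_nat z = of_nat (M\<^sup>2 * z) * (r b - r a)"
      by (simp add: r_def power2_eq_square algebra_simps)
    also have "\<dots> = of_nat (rden (r b)) * r b - of_nat (rden (r a)) * r a"
      using rA that by (simp add: right_diff_distrib)
    finally show ?thesis by (simp add: of_nat_rden_mult)
  qed
  have sub: "cls ` A \<subseteq> {d. d dvd L} \<times> UNIV"
  proof -
    have "rden (w a) dvd L" if "a \<in> A" for a
    proof -
      have "of_nat L * a \<in> \<int>" "of_nat L * a0 \<in> \<int>"
        using den_dvd_L that a0 by (auto simp flip: rden_dvd_iff)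
      then have "of_nat M * (of_nat L * a - of_nat L * a0) \<in> \<int>"
        using Ints_mult[OF Ints_of_nat Ints_diff] by blast
      then show ?thesis by (simp add: rden_dvd_iff w_def algebra_simps)
    qed
    then show ?thesis by (auto simp: cls_def)
  qed
  have "real (card A) \<le> (\<Sum>b \<in> {d. d dvd L} \<times> (UNIV :: bool set). 3 * sqrt (h / z))"
  proof (rule card_le_sum_fibers[OF fin _ sub])
    fix b :: "nat \<times> bool"
    define G where "G = {a \<in> A. cls a = b}"
    \<comment> \<open>\<open>M * (x - y)\<close> is a difference of two values of \<open>w\<close>
      with the same denominator, and also a difference of two values of \<open>w'\<close>. The
      denominators of the former are coprime to those of the latter, so it is an integer.\<close>
    have Ints: "of_nat M * (x - y) \<in> \<int>" if xy: "x \<in> G" "y \<in> G" for x y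
    proof -
      have A: "x \<in> A" "y \<in> A" and same: "rden (w x) = rden (w y)" using xy by (auto simp: G_def cls_def)
      have cop: "coprime (rden (w a)) (rden (w' a))" if "a \<in> A" for a
        using diff[OF that a0] by (intro coprime_rden_if_squarefree_mult_Ints[OF z(1)]) 
          (simp add: w_def w'_def mult_ac)
      have "of_nat M * (x - y) = w x - w y" "of_nat M * (x - y) = w' x - w' y"
        by (simp_all add: w_def w'_def algebra_simps)
      then have "rden (of_nat M * (x - y)) dvd rden (w x)" 
        and "rden (of_nat M * (x - y)) dvd lcm (rden (w' x)) (rden (w' y))"
        using rden_diff_dvd_lcm[of "w x" "w y"] rden_diff_dvd_lcm[of "w' x" "w' y"] same by auto
      moreover have "coprime (rden (w x)) (lcm (rden (w' x)) (rden (w' y)))"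
      proof -
        have "coprime (rden (w x)) (rden (w' x) * rden (w' y))"
          using cop[OF A(1)] cop[OF A(2)] same by simp
        moreover have "lcm (rden (w' x)) (rden (w' y)) dvd rden (w' x) * rden (w' y)" 
          by (rule lcm_least) auto
        ultimately show ?thesis by (meson coprime_divisors dvd_refl)
      qed
      ultimately have "is_unit (rden (of_nat M * (x - y)))" by (meson coprime_common_divisor) 
      then show ?thesis using rden_dvd_iff[of "of_nat M * (x - y)" 1] by simp
    qed
    show "real (card {a \<in> A. cls a = b}) \<le> 3 * sqrt (h / z)"
    proof (cases "G = {}")
      case True
      then have "card {a \<in> A. cls a = b} = 0" unfolding G_def by (simp only: card.empty)
      then show ?thesis using z by simp
    next
      case False
      then obtain a1 where a1: "a1 \<in> G" by blast
      define k where "k = (\<lambda>a. \<lfloor>of_nat M * (a - a1)\<rfloor>)"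
      have k: "of_int (k a) = of_nat M * (a - a1)" if "a \<in> G" for a
        using Ints[OF that a1] by (auto simp: k_def elim: Ints_cases)
      have kd: "of_int (k x - k y) = of_nat M * (x - y)" if "x \<in> G" "y \<in> G" for x y
        using that by (simp add: k algebra_simps)
      have inj: "inj_on k G"
      proof (rule inj_onI)
        fix x y assume xy: "x \<in> G" "y \<in> G" "k x = k y"
        then show "x = y" using kd[OF xy(1,2)] z by simp
      qed
      have "real (card (k ` G)) \<le> sqrt (2 * h / z) / real_of_int 1 + 1"
      proof (rule card_le_if_spaced)
        fix i j assume "i \<in> k ` G" "j \<in> k ` G"
        then obtain x y where xy: "x \<in> G" "y \<in> G" "i = k x" "j = k y" by blast
        have A: "x \<in> A" "y \<in> A" and sgn: "(2 * x \<ge> t) = (2 * y \<ge> t)" using xy by (auto simp: G_def cls_def)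
        \<comment> \<open>\<open>x - y\<close> and \<open>x + y - t\<close> are half the difference
          and half the sum of \<open>2 * x - t\<close> and \<open>2 * y - t\<close>, which do not
          have opposite signs.\<close>
        have "\<bar>x - y\<bar> \<le> \<bar>x + y - t\<bar>" using sgn by (auto simp: abs_if)
        then have "of_nat z * (of_nat M * \<bar>x - y\<bar>) * (of_nat M * \<bar>x - y\<bar>) \<le> 
          of_nat z * (of_nat M * \<bar>x - y\<bar>) * (of_nat M * \<bar>x + y - t\<bar>)" by (intro mult_left_mono) auto
        also have "\<dots> = \<bar>of_nat M * (x - y) * (of_nat M * (x + y - t)) * of_nat z\<bar>"
          by (simp add: abs_mult mult_ac)
        also have "\<dots> = of_int \<bar>rnum (r y) - rnum (r x)\<bar>" unfolding diff[OF A] by simp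
        also have "of_nat z * (of_nat M * \<bar>x - y\<bar>) * (of_nat M * \<bar>x - y\<bar>) = of_int (int z * (i - j)\<^sup>2)"
          using kd[OF xy(1,2)] xy(3,4) by (simp add: power2_eq_square abs_mult_self_eq mult_ac flip: abs_mult)
        finally have "int z * (i - j)\<^sup>2 \<le> \<bar>rnum (r y) - rnum (r x)\<bar>" by (simp only: of_int_le_iff)
        then have "real_of_int (int z * (i - j)\<^sup>2) \<le> real_of_int \<bar>rnum (r y) - rnum (r x)\<bar>" 
          by (simp only: of_int_le_iff)
        also have "\<dots> \<le> 2 * h" using rA[OF A(1)] rA[OF A(2)] by (auto simp: farey_rats_iff)
        finally have "(real_of_int (i - j))\<^sup>2 \<le> 2 * h / z" using z by (simp add: field_simps)
        then show "real_of_int (i - j) \<le> sqrt (2 * h / z)" by (rule real_le_rsqrt)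
      qed (use fin z in \<open>auto simp: G_def\<close>)
      also have "\<dots> \<le> 3 * sqrt (h / z)"
      proof -
        have "1 \<le> sqrt (h / z)" using z by simp
        moreover have "sqrt (2 * h / z) \<le> sqrt (4 * (h / z))" using z by (intro real_sqrt_le_mono) (simp add: divide_right_mono)
        moreover have "sqrt (4 * (h / z)) = 2 * sqrt (h / z)" by (simp only: real_sqrt_mult real_sqrt_four)
        ultimately show ?thesis by linarith
      qed
      finally show ?thesis unfolding card_image[OF inj] unfolding G_def .
    qed
  qed (use L0 in auto)
  also have "\<dots> = real (card {d. d dvd L}) * (6 * sqrt (h / z))"
    by (simp add: card_cartesian_product card_UNIV_bool)
  also have "\<dots> \<le> D * (6 * sqrt (h / z))" using D z by (intro mult_right_mono) (auto simp: L_def)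
  finally show ?thesis by (simp add: mult_ac)
qed

text \<open>The solutions are sorted by the denominator \<open>M\<^sup>2 * z\<close> of
  \<open>r a\<close> with \<open>z\<close> squarefree. Each \<open>z\<close> admits at most
  \<open>sqrt (h / z)\<close> values of \<open>M\<close>, each with about
  \<open>sqrt (h / z)\<close> solutions, hence about \<open>h / z\<close> in all; the sum over
  \<open>z\<close> costs a logarithm.\<close>

lemma card_quadratic_values:
  fixes t c :: rat
  defines "r \<equiv> \<lambda>a. a * (t - a) - c"
  assumes h: "1 \<le> h" "h \<le> H\<^sup>2" and H: "H \<ge> 1" and D: "divisor_bound (H ^ 8) D"
  shows "real (card {a \<in> farey_rats H. t - a \<in> farey_rats H \<and> r a \<in> farey_rats h}) \<le> 6 * D * (1 + ln h) * h"
    (is "real (card ?A) \<le> _")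
proof -
  have fin: "finite ?A" by simp
  have D1: "D \<ge> 1" using divisor_bound_ge_1[OF D] H by simp
  let ?z = "\<lambda>a. squarefree_part (rden (r a))" and ?M = "\<lambda>a. square_part (rden (r a))"
  have rden_r: "rden (r a) = (?M a)\<^sup>2 * ?z a" for a
    using squarefree_decompose[of "rden (r a)"] by (simp add: mult.commute)
  have pos: "?z a > 0" "?M a > 0" for a
    using rden_r[of a] rden_pos[of "r a"] by (metis mult_0_right gr0I less_irrefl, metis mult_0 power_zero_numeral gr0I less_irrefl)
  have le_h: "real ((?M a)\<^sup>2 * ?z a) \<le> h" if "a \<in> ?A" for a
    using that by (auto simp: farey_rats_iff simp flip: rden_r)
  \<comment> \<open>A single solution \<open>a\<close> bounds the denominators of
    \<open>t = a + (t - a)\<close> and \<open>c = a * (t - a) - r a\<close> by \<open>H ^ 2\<close>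
    and \<open>H ^ 2 * h\<close>. With \<open>h \<le> H ^ 2\<close> the product is at most
    \<open>H ^ 8\<close>.\<close>
  have divs: "real (card {d. d dvd rden (r a) * rden t * rden c}) \<le> D" if a: "a \<in> ?A" for a
  proof (rule divisor_boundD[OF D])
    have dens: "real (rden a) \<le> H" "real (rden (t - a)) \<le> H" "real (rden (r a)) \<le> h" 
      using a by (auto simp: farey_rats_iff)
    have "rden t dvd lcm (rden a) (rden (t - a))" using rden_add_dvd_lcm[of a "t - a"] by simp
    also have "\<dots> dvd rden a * rden (t - a)" by (rule lcm_least) simp_all
    finally have "rden t \<le> rden a * rden (t - a)" by (intro dvd_imp_le) (simp_all add: rden_pos)
    then have "real (rden t) \<le> real (rden a) * real (rden (t - a))" 
      unfolding of_nat_mult[symmetric] by (rule of_nat_mono)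
    also have "\<dots> \<le> H * H" using dens H by (intro mult_mono) auto
    finally have t: "real (rden t) \<le> H * H" .
    have "of_nat (rden a * rden (t - a) * rden (r a)) * c =
        of_nat (rden (r a)) * ((of_nat (rden a) * a) * (of_nat (rden (t - a)) * (t - a))) 
        - of_nat (rden a * rden (t - a)) * (of_nat (rden (r a)) * r a)"
      by (simp add: r_def algebra_simps)
    also have "\<dots> \<in> \<int>" unfolding of_nat_rden_mult by (intro Ints_diff Ints_mult) auto
    finally have "rden c dvd rden a * rden (t - a) * rden (r a)" by (simp only: rden_dvd_iff)
    then have "rden c \<le> rden a * rden (t - a) * rden (r a)" by (intro dvd_imp_le) (simp_all add: rden_pos)
    then have "real (rden c) \<le> real (rden a) * real (rden (t - a)) * real (rden (r a))" 
      unfolding of_nat_mult[symmetric] by (rule of_nat_mono)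
    also have "\<dots> \<le> H * H * h" using dens H by (intro mult_mono) auto
    finally have c: "real (rden c) \<le> H * H * h" .
    have "real (rden (r a) * rden t * rden c) = real (rden (r a)) * real (rden t) * real (rden c)" by simp
    also have "\<dots> \<le> h * (H * H) * (H * H * h)" using dens t c H h by (intro mult_mono) auto
    also have "\<dots> \<le> H\<^sup>2 * (H * H) * (H * H * H\<^sup>2)" using h H by (intro mult_mono) auto
    also have "\<dots> = H ^ 8" by (simp add: power2_eq_square numeral_eq_Suc)
    finally show "real (rden (r a) * rden t * rden c) \<le> H ^ 8" .
  qed (simp add: rden_pos)
  have "real (card ?A) \<le> (\<Sum>z = 1..nat \<lfloor>h\<rfloor>. 6 * D * h * (1 / real z))"
  proof (rule card_le_sum_fibers[OF fin])
    show "?z ` ?A \<subseteq> {1..nat \<lfloor>h\<rfloor>}"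
    proof safe
      fix a assume "a \<in> farey_rats H" "t - a \<in> farey_rats H" "r a \<in> farey_rats h"
      then have "real ((?M a)\<^sup>2 * ?z a) \<le> h" using le_h by blast
      moreover have "?z a \<le> (?M a)\<^sup>2 * ?z a" using pos[of a] by simp
      ultimately have "real (?z a) \<le> h" by (meson of_nat_mono order_trans)
      then show "?z a \<in> {1..nat \<lfloor>h\<rfloor>}" using pos(1)[of a] by (simp add: le_nat_floor Suc_le_eq)
    qed
    fix z assume z: "z \<in> {1..nat \<lfloor>h\<rfloor>}"
    define s where "s = sqrt (h / z)"
    have zh: "real z \<le> h" and z0: "z > 0" using z h by (auto simp: le_nat_iff le_floor_iff)
    have s1: "s \<ge> 1" using zh z0 by (simp add: s_def)
    let ?B = "{a \<in> ?A. ?z a = z}"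
    have "real (card ?B) \<le> (\<Sum>M = 1..nat \<lfloor>s\<rfloor>. 6 * D * s)"
    proof (rule card_le_sum_fibers)
      show "?M ` ?B \<subseteq> {1..nat \<lfloor>s\<rfloor>}"
      proof
        fix M assume "M \<in> ?M ` ?B"
        then obtain a where a: "a \<in> ?A" "?z a = z" "M = ?M a" by blast
        have "real (M\<^sup>2 * z) \<le> h" using le_h[OF a(1)] a by simp
        then have "(real M)\<^sup>2 \<le> h / z" using z0 by (simp add: field_simps)
        then have "real M \<le> s" unfolding s_def by (rule real_le_rsqrt)
        then show "M \<in> {1..nat \<lfloor>s\<rfloor>}" using pos(2)[of a] a(3) by (simp add: le_nat_floor Suc_le_eq)
      qed
      fix M assume M: "M \<in> {1..nat \<lfloor>s\<rfloor>}"
      let ?C = "{a \<in> ?B. ?M a = M}"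
      show "real (card ?C) \<le> 6 * D * s"
      proof (cases "?C = {}")
        case True
        then show ?thesis using D1 s1 by (simp only: card.empty) simp
      next
        case False
        then obtain a where a: "a \<in> ?C" by blast
        have den: "rden (r a) = M\<^sup>2 * z" if "a \<in> ?C" for a using rden_r[of a] that by simp
        have sqf: "squarefree z" using a squarefree_squarefree_part[of "rden (r a)"] by auto
        have vals: "b * (t - b) - c \<in> farey_rats h \<and> rden (b * (t - b) - c) = M\<^sup>2 * z" if "b \<in> ?C" for b
        proof -
          have "r b \<in> farey_rats h \<and> rden (r b) = M\<^sup>2 * z" using that den[OF that] by simp
          then show ?thesis by (simp only: r_def)
        qed
        have D': "real (card {d. d dvd M\<^sup>2 * z * rden t * rden c}) \<le> D"
          using divs[of a] a unfolding den[OF a] by simp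
        have M0: "M > 0" using M by simp
        show ?thesis unfolding s_def
          by (rule card_quadratic_values_fixed_den[OF _ sqf z0 M0 zh vals D']) simp
      qed
    qed auto
    also have "\<dots> = real (nat \<lfloor>s\<rfloor>) * (6 * D * s)" by simp
    also have "\<dots> \<le> s * (6 * D * s)" using s1 D1 by (intro mult_right_mono) auto
    also have "\<dots> = 6 * D * (s * s)" by simp
    also have "s * s = h / z" using h by (simp add: s_def)
    finally show "real (card ?B) \<le> 6 * D * h * (1 / real z)" by simp
  qed simp
  also have "\<dots> = 6 * D * h * (\<Sum>z = 1..nat \<lfloor>h\<rfloor>. 1 / real z)" by (simp add: sum_distrib_left)
  also have "\<dots> \<le> 6 * D * h * (1 + ln h)" 
    using sum_inverse_le_ln[OF h(1)] D1 h by (intro mult_left_mono) auto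
  finally show ?thesis by (simp add: mult_ac)
qed

section \<open>Counting matrices\<close>

text \<open>The divisor bound and \<open>1 + ln H\<close> are both at most a constant times an
  arbitrarily small power of \<open>H\<close>, so fixed powers of them fit into
  \<open>H powr \<epsilon>\<close>.\<close>

lemma divisor_bound_powr_absorb:
  fixes K \<epsilon> :: real and s p q c :: nat
  assumes "K \<ge> 0" "\<epsilon> > 0"
  shows "\<exists>H0\<ge>1. \<forall>H\<ge>H0. \<exists>D. divisor_bound (H ^ s) D \<and>
    K * D ^ p * (1 + ln H) ^ q * H ^ c \<le> H powr (real c + \<epsilon>)"
proof -
  \<comment> \<open>Chosen so that the \<open>s * p + q\<close> factors
    \<open>H powr \<delta>\<close> cost at most \<open>H powr (\<epsilon> / 2)\<close> together; the
    other half of \<open>\<epsilon>\<close> pays for the constant \<open>K'\<close> through the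
    choice of \<open>H0\<close>. The summand 1 avoids a zero denominator.\<close>
  define \<delta> where "\<delta> = \<epsilon> / (2 * (real s * real p + real q + 1))"
  have den: "2 * (real s * real p + real q + 1) > 0" by (simp add: add_nonneg_pos)
  have \<delta>: "\<delta> > 0" using assms(2) den by (simp add: \<delta>_def)
  have \<delta>\<epsilon>: "\<delta> * (real s * real p + real q) \<le> \<epsilon> / 2"
    using assms(2) den by (simp add: \<delta>_def field_simps)
  obtain C where C: "C \<ge> 1" "\<And>n. n > 0 \<Longrightarrow> real (card {d :: nat. d dvd n}) \<le> C * real n powr \<delta>"
    using card_divisors_le_powr[OF \<delta>] by blast
  define K' where "K' = K * C ^ p * (1 + 1 / \<delta>) ^ q"
  have K': "K' \<ge> 0" using assms(1) C(1) \<delta> by (simp add: K'_def)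
  define H0 where "H0 = max 1 (K' powr (2 / \<epsilon>))"
  show ?thesis
  proof (rule exI[of _ H0], intro conjI allI impI)
    show "H0 \<ge> 1" by (simp add: H0_def)
    fix H assume "H \<ge> H0"
    then have H: "H \<ge> 1" "K' powr (2 / \<epsilon>) \<le> H" by (simp_all add: H0_def)
    define D where "D = C * (H powr \<delta>) ^ s"
    have Hs: "(H ^ s) powr \<delta> = (H powr \<delta>) ^ s"
      using H by (simp add: powr_powr mult.commute flip: powr_realpow)
    have "divisor_bound (H ^ s) D"
      unfolding divisor_bound_def
    proof (intro allI impI)
      fix n :: nat assume n: "0 < n \<and> real n \<le> H ^ s"
      have "real n powr \<delta> \<le> (H ^ s) powr \<delta>" using n \<delta> by (intro powr_mono2) auto
      then have "C * real n powr \<delta> \<le> D" unfolding D_def Hs[symmetric] using C(1) by (intro mult_left_mono) auto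
      then show "real (card {d. d dvd n}) \<le> D" using C(2)[of n] n by linarith
    qed
    moreover have "K * D ^ p * (1 + ln H) ^ q * H ^ c \<le> H powr (real c + \<epsilon>)"
    proof -
      have P1: "H powr \<delta> \<ge> 1" using H \<delta> by (simp add: ge_one_powr_ge_zero)
      have "\<delta> * ln H \<le> H powr \<delta>"
      proof -
        have "H powr \<delta> = exp (\<delta> * ln H)" using H(1) by (simp add: powr_def)
        then show ?thesis using exp_ge_add_one_self[of "\<delta> * ln H"] by linarith
      qed
      then have "ln H \<le> H powr \<delta> / \<delta>" using \<delta> by (simp add: field_simps)
      then have "1 + ln H \<le> (1 + 1 / \<delta>) * H powr \<delta>" using P1 by (simp add: algebra_simps)
      then have "(1 + ln H) ^ q \<le> ((1 + 1 / \<delta>) * H powr \<delta>) ^ q" using H by (intro power_mono) auto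
      then have "K * D ^ p * (1 + ln H) ^ q * H ^ c \<le> K * D ^ p * ((1 + 1 / \<delta>) * H powr \<delta>) ^ q * H ^ c"
        using assms(1) C(1) H by (intro mult_right_mono mult_left_mono) (auto simp: D_def)
      also have "\<dots> = K' * ((H powr \<delta>) ^ (s * p) * (H powr \<delta>) ^ q) * H ^ c"
        by (simp add: D_def K'_def power_mult_distrib power_mult)
      also have "(H powr \<delta>) ^ (s * p) * (H powr \<delta>) ^ q = H powr (\<delta> * (real s * real p + real q))"
        using H P1 by (simp add: powr_powr powr_realpow[symmetric] powr_add[symmetric] algebra_simps)
      also have "K' * H powr (\<delta> * (real s * real p + real q)) * H ^ c \<le> H powr (\<epsilon> / 2) * H powr (\<epsilon> / 2) * H ^ c"
      proof (intro mult_right_mono mult_mono)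
        have "(K' powr (2 / \<epsilon>)) powr (\<epsilon> / 2) \<le> H powr (\<epsilon> / 2)" using H assms(2) by (intro powr_mono2) auto
        then show "K' \<le> H powr (\<epsilon> / 2)" using assms(2) K' by (simp add: powr_powr)
        show "H powr (\<delta> * (real s * real p + real q)) \<le> H powr (\<epsilon> / 2)" using \<delta>\<epsilon> H by (intro powr_mono) auto
      qed (use H in auto)
      also have "\<dots> = H powr (real c + \<epsilon>)"
        using H by (simp add: powr_realpow[symmetric] add.commute flip: powr_add)
      finally show ?thesis .
    qed
    ultimately show "\<exists>D. divisor_bound (H ^ s) D \<and> 
      K * D ^ p * (1 + ln H) ^ q * H ^ c \<le> H powr (real c + \<epsilon>)" by blast
  qed
qed

section \<open>The trace equations and the count for general \<open>n\<close>\<close>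

lemma sum_symmetric_square:
  fixes f :: "nat \<Rightarrow> nat \<Rightarrow> 'a :: comm_ring_1"
  assumes "\<And>i j. f i j = f j i"
  shows "(\<Sum>i<n. \<Sum>j<n. f i j) = (\<Sum>i<n. f i i) + 2 * (\<Sum>j<n. \<Sum>i<j. f j i)"
proof (induction n)
  case (Suc n)
  have "(\<Sum>i<n. f i n) = (\<Sum>i<n. f n i)" using assms by simp
  then show ?case using Suc by (simp add: sum.distrib algebra_simps)
qed simp

lemma double_sum_lessThan: "2 * (\<Sum>j<n. j) + n = n\<^sup>2" for n :: nat
  by (induction n) (auto simp: power2_eq_square)

text \<open>Comparison with a second matrix of the family makes both traces constant without
  expressing them through the coefficients of \<open>f\<close>. Symmetry splits the trace of the
  square into diagonal squares and twice the products of opposite entries.\<close>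

lemma rat_mats_char_poly_traces:
  assumes "A \<in> rat_mats_char_poly n H f" "B \<in> rat_mats_char_poly n H f"
  shows "(\<Sum>i<n. A $$ (i, i)) = (\<Sum>i<n. B $$ (i, i))"
    and "(\<Sum>i<n. (A $$ (i, i))\<^sup>2) + 2 * (\<Sum>j<n. \<Sum>i<j. A $$ (j, i) * A $$ (i, j)) =
         (\<Sum>i<n. (B $$ (i, i))\<^sup>2) + 2 * (\<Sum>j<n. \<Sum>i<j. B $$ (j, i) * B $$ (i, j))"
proof -
  have AB: "A \<in> carrier_mat n n" "B \<in> carrier_mat n n" "char_poly A = char_poly B"
    using assms by (auto simp: rat_mats_char_poly_def rat_mats_def)
  have *: "(\<Sum>i<n. \<Sum>j<n. M $$ (i, j) * M $$ (j, i)) =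
     (\<Sum>i<n. (M $$ (i, i))\<^sup>2) + 2 * (\<Sum>j<n. \<Sum>i<j. M $$ (j, i) * M $$ (i, j))" for M :: "rat mat"
    unfolding power2_eq_square by (rule sum_symmetric_square) (rule mult.commute)
  show "(\<Sum>i<n. A $$ (i, i)) = (\<Sum>i<n. B $$ (i, i))"
    by (rule char_poly_eq_imp_traces_eq(1)[OF AB])
  show "(\<Sum>i<n. (A $$ (i, i))\<^sup>2) + 2 * (\<Sum>j<n. \<Sum>i<j. A $$ (j, i) * A $$ (i, j)) =
         (\<Sum>i<n. (B $$ (i, i))\<^sup>2) + 2 * (\<Sum>j<n. \<Sum>i<j. B $$ (j, i) * B $$ (i, j))"
    using char_poly_eq_imp_traces_eq(2)[OF AB] unfolding * .
qed

lemma rat_mats_char_poly_entry: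
  "A \<in> rat_mats_char_poly n H f \<Longrightarrow> i < n \<Longrightarrow> j < n \<Longrightarrow> A $$ (i, j) \<in> farey_rats H"
  by (auto simp: rat_mats_char_poly_def rat_mats_def)

text \<open>A matrix is encoded by its diagonal \<open>d\<close> and the family \<open>e\<close> of
  pairs of opposite entries. The trace fixes the sum of \<open>d\<close>, and the trace of the
  square then fixes the sum of products over \<open>e\<close>; \<open>n\<close> convolutions with
  fractions and \<open>m\<close> with products give the two factors.\<close>

lemma card_rat_mats_char_poly_le:
  fixes n :: nat
  assumes H: "H \<ge> 1" and D: "divisor_bound (H ^ (n\<^sup>2 + 8)) D"
  defines "m \<equiv> \<Sum>j<n. j"
  shows "real (card (rat_mats_char_poly n H f)) \<le>
    (3 * D\<^sup>2 * (1 + ln H) * H) ^ n * (36 * D ^ 4 * (1 + ln H) ^ 3 * H\<^sup>2) ^ m" (is "_ \<le> ?B1 ^ n * ?B2 ^ m")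
proof (cases "rat_mats_char_poly n H f = {}")
  case True
  then show ?thesis using H by simp
next
  case False
  define S where "S = rat_mats_char_poly n H f"
  obtain A0 where A0: "A0 \<in> S" using False by (auto simp: S_def)
  define t s where "t = (\<Sum>i<n. A0 $$ (i, i))"
    and "s = (\<Sum>i<n. (A0 $$ (i, i))\<^sup>2) + 2 * (\<Sum>j<n. \<Sum>i<j. A0 $$ (j, i) * A0 $$ (i, j))"
  define F P where "F = farey_rats H" and "P = (SIGMA j:{..<n}. {..<j})"
  define DD where "DD = {d \<in> {..<n} \<rightarrow>\<^sub>E F. (\<Sum>i<n. d i) = t}"
  define EE where "EE = (\<lambda>c. {e \<in> P \<rightarrow>\<^sub>E F \<times> F. (\<Sum>p\<in>P. case e p of (x, y) \<Rightarrow> x * y) = c})"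
  \<comment> \<open>The value that the trace of the square forces on the sum of products once the
    diagonal \<open>d\<close> is known.\<close>
  define cc where "cc = (\<lambda>d. (s - (\<Sum>i<n. (d i)\<^sup>2)) / 2 :: rat)"
  have m: "2 * m + n = n\<^sup>2" unfolding m_def by (rule double_sum_lessThan)
  have finP: "finite P" and cardP: "card P = m" by (simp_all add: P_def m_def)
  have finF: "finite F" by (simp add: F_def)
  have lnH: "ln H \<ge> 0" using H by simp
  have B: "?B1 \<ge> 0" "?B2 \<ge> 0" using lnH H by simp_all
  have boundD: "real (card DD) \<le> ?B1 ^ n"
  proof -
    have "real (card DD) \<le> ?B1 ^ card {..<n} * den_weight (H ^ card {..<n}) t"
      unfolding DD_def
    proof (rule card_PiE_sum_eq_le[where k = n])
      \<comment> \<open>The diagonal needs divisor bounds up to \<open>H ^ (n + 1)\<close>, the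
        products below up to \<open>H ^ (2 * m + 2)\<close>; by \<open>2 * m + n = n\<^sup>2\<close>
        the exponent \<open>n\<^sup>2 + 8\<close> covers both.\<close>
      fix R :: real and c assume R: "1 \<le> R" "R * H \<le> H ^ n"
      have "R * H * H \<le> H ^ n * H" using R H by (intro mult_right_mono) auto
      also have "\<dots> = H ^ (n + 1)" by simp
      also have "\<dots> \<le> H ^ (n\<^sup>2 + 8)" using H m by (intro power_increasing) auto
      finally show "(\<Sum>x\<in>F. den_weight R (c - x)) \<le> ?B1 * den_weight (R * H) c"
        unfolding F_def using divisor_bound_mono[OF D] H R by (intro sum_den_weight_farey_rats) auto
    qed (use finF H B in auto)
    also have "\<dots> \<le> ?B1 ^ n * 1" using B by (intro mult_mono den_weight_le_1) auto
    finally show ?thesis by simp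
  qed
  have boundE: "real (card (EE c)) \<le> ?B2 ^ m" for c
  proof -
    have "real (card (EE c)) \<le> ?B2 ^ card P * den_weight ((H\<^sup>2) ^ card P) c"
      unfolding EE_def
    proof (rule card_PiE_sum_eq_le[where k = m])
      fix R :: real and c assume R: "1 \<le> R" "R * H\<^sup>2 \<le> (H\<^sup>2) ^ m"
      have "R * H ^ 4 = R * H\<^sup>2 * H\<^sup>2" by (simp flip: power_add)
      also have "\<dots> \<le> (H\<^sup>2) ^ m * H\<^sup>2" using R H by (intro mult_right_mono) auto
      also have "\<dots> = H ^ (2 * m + 2)" by (simp add: power_mult power_add power2_eq_square)
      also have "\<dots> \<le> H ^ (n\<^sup>2 + 8)" using H m by (intro power_increasing) auto
      finally have "divisor_bound (R * H ^ 4) D" by (rule divisor_bound_mono[OF D])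
      from sum_den_weight_products[OF H R(1) this, of c]
      show "(\<Sum>z\<in>F \<times> F. den_weight R (c - (case z of (x, y) \<Rightarrow> x * y))) \<le> ?B2 * den_weight (R * H\<^sup>2) c"
        by (simp add: F_def case_prod_unfold)
    qed (use finF finP cardP H B in auto)
    also have "\<dots> \<le> ?B2 ^ m * 1" unfolding cardP using B by (intro mult_mono den_weight_le_1) auto
    finally show ?thesis by simp
  qed
  define \<Psi> where "\<Psi> = (\<lambda>A :: rat mat. (restrict (\<lambda>i. A $$ (i, i)) {..<n}, restrict (\<lambda>(j, i). (A $$ (j, i), A $$ (i, j))) P))"
  have "inj_on \<Psi> S"
  proof (rule inj_onI)
    fix A B assume AB: "A \<in> S" "B \<in> S" "\<Psi> A = \<Psi> B"
    have diag: "A $$ (i, i) = B $$ (i, i)" if "i < n" for i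
      using fun_cong[OF arg_cong[OF AB(3), of fst], of i] that by (simp add: \<Psi>_def)
    have off: "A $$ (j, i) = B $$ (j, i) \<and> A $$ (i, j) = B $$ (i, j)" if "i < j" "j < n" for i j
      using fun_cong[OF arg_cong[OF AB(3), of snd], of "(j, i)"] that by (simp add: \<Psi>_def P_def)
    have "A $$ (i, j) = B $$ (i, j)" if "i < n" "j < n" for i j
      using that diag off by (cases i j rule: linorder_cases) auto
    then show "A = B" using AB(1,2) by (intro eq_matI) (auto simp: S_def rat_mats_char_poly_def rat_mats_def)
  qed
  moreover have "\<Psi> ` S \<subseteq> (SIGMA d:DD. EE (cc d))"
  proof
    fix x assume "x \<in> \<Psi> ` S"
    then obtain A where A: "A \<in> S" "x = \<Psi> A" by blast
    define d e where "d = restrict (\<lambda>i. A $$ (i, i)) {..<n}" and "e = restrict (\<lambda>(j, i). (A $$ (j, i), A $$ (i, j))) P"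
    have x: "x = (d, e)" by (simp add: A \<Psi>_def d_def e_def)
    have F: "A $$ (i, j) \<in> F" if "i < n" "j < n" for i j
      using rat_mats_char_poly_entry[OF A(1)[unfolded S_def] that] by (simp add: F_def)
    have "d \<in> DD"
      using rat_mats_char_poly_traces(1)[OF A(1)[unfolded S_def] A0[unfolded S_def]] F
      by (auto simp: DD_def d_def t_def)
    moreover have "e \<in> P \<rightarrow>\<^sub>E F \<times> F" using F by (auto simp: e_def P_def)
    moreover have "(\<Sum>p\<in>P. case e p of (x, y) \<Rightarrow> x * y) = cc d"
    proof -
      have "(\<Sum>p\<in>P. case e p of (x, y) \<Rightarrow> x * y) = (\<Sum>(j, i)\<in>P. A $$ (j, i) * A $$ (i, j))"
        by (intro sum.cong) (auto simp: e_def)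
      also have "\<dots> = (\<Sum>j<n. \<Sum>i<j. A $$ (j, i) * A $$ (i, j))" unfolding P_def by (simp add: sum.Sigma)
      also have "\<dots> = cc d"
        using rat_mats_char_poly_traces(2)[OF A(1)[unfolded S_def] A0[unfolded S_def], folded s_def]
        by (simp add: cc_def d_def field_simps)
      finally show ?thesis .
    qed
    ultimately show "x \<in> (SIGMA d:DD. EE (cc d))" by (simp add: x EE_def)
  qed
  moreover have finE: "finite (EE c)" for c unfolding EE_def using finP finF
    by (intro finite_subset[OF Collect_restrict] finite_PiE) auto
  moreover have finD: "finite DD" unfolding DD_def using finF
    by (intro finite_subset[OF Collect_restrict] finite_PiE) auto
  ultimately have "card S \<le> card (SIGMA d:DD. EE (cc d))" by (intro card_inj_on_le) auto
  also have "\<dots> = (\<Sum>d\<in>DD. card (EE (cc d)))" using finD finE by simp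
  finally have "real (card S) \<le> (\<Sum>d\<in>DD. real (card (EE (cc d))))" 
    unfolding of_nat_sum[symmetric] by (rule of_nat_mono)
  also have "\<dots> \<le> (\<Sum>d\<in>DD. ?B2 ^ m)" by (intro sum_mono boundE)
  also have "\<dots> = real (card DD) * ?B2 ^ m" by simp
  also have "\<dots> \<le> ?B1 ^ n * ?B2 ^ m" using boundD B by (intro mult_right_mono) auto
  finally show ?thesis by (simp add: S_def)
qed

section \<open>The case \<open>n = 2\<close>\<close>

text \<open>The upper left entry \<open>a\<close> determines the lower right entry
  \<open>t - a\<close> and the off-diagonal product \<open>a * (t - a) - c\<close>. Factorisations
  of this product are counted through the heights \<open>H\<^sup>2 / (e * f)\<close>; after
  exchanging sums, each \<open>(e, f)\<close> admits about that many \<open>a\<close>, in total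
  about \<open>H\<^sup>2\<close>.\<close>

lemma card_rat_mats_char_poly_2_le:
  assumes H: "H \<ge> 1" and D: "divisor_bound (H ^ 8) D"
  shows "real (card (rat_mats_char_poly 2 H f)) \<le> 72 * D ^ 3 * (1 + ln H) ^ 3 * H\<^sup>2"
proof (cases "rat_mats_char_poly 2 H f = {}")
  case True
  have "D \<ge> 1" using divisor_bound_ge_1[OF D] H by simp
  then show ?thesis using H True by simp
next
  case False
  define S where "S = rat_mats_char_poly 2 H f"
  obtain A0 where A0: "A0 \<in> S" using False by (auto simp: S_def)
  define t s where "t = (\<Sum>i<2. A0 $$ (i, i))"
    and "s = (\<Sum>i<2. (A0 $$ (i, i))\<^sup>2) + 2 * (\<Sum>j<2. \<Sum>i<j. A0 $$ (j, i) * A0 $$ (i, j))"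
  \<comment> \<open>The common determinant, as \<open>t\<close> is the trace and \<open>s\<close>
    the trace of the square.\<close>
  define c where "c = (t\<^sup>2 - s) / 2"
  define F N where "F = farey_rats H" and "N = {1..nat \<lfloor>H\<rfloor>}"
  define h where "h = (\<lambda>e f. H\<^sup>2 / (real e * real f))"
  define X where "X = {a \<in> F. t - a \<in> F}"
  define W where "W = (\<lambda>a. {(x, y) \<in> F \<times> F. x * y = a * (t - a) - c})"
  have D1: "D \<ge> 1" using divisor_bound_ge_1[OF D] H by simp
  have D2: "divisor_bound (H\<^sup>2) D" using H by (intro divisor_bound_mono[OF D] power_increasing) auto
  have lnH: "ln H \<ge> 0" using H by simp
  have finX: "finite X" by (simp add: X_def F_def)
  have finW: "finite (W a)" for a unfolding W_def F_def by (rule finite_subset[of _ "farey_rats H \<times> farey_rats H"]) auto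
  define \<Psi> where "\<Psi> = (\<lambda>A :: rat mat. (A $$ (0, 0), A $$ (0, 1), A $$ (1, 0)))"
  have tr: "A $$ (1, 1) = t - A $$ (0, 0) \<and> A $$ (0, 1) * A $$ (1, 0) = A $$ (0, 0) * (t - A $$ (0, 0)) - c" 
    if A: "A \<in> S" for A
  proof -
    have t: "A $$ (1, 1) = t - A $$ (0, 0)"
      using rat_mats_char_poly_traces(1)[OF A[unfolded S_def] A0[unfolded S_def]]
      by (simp add: t_def numeral_2_eq_2 algebra_simps)
    have "(A $$ (0, 0))\<^sup>2 + (A $$ (1, 1))\<^sup>2 + 2 * (A $$ (0, 1) * A $$ (1, 0)) = s"
      using rat_mats_char_poly_traces(2)[OF A[unfolded S_def] A0[unfolded S_def], folded s_def]
      by (simp add: numeral_2_eq_2 algebra_simps)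
    then show ?thesis unfolding t c_def by (simp add: power2_eq_square field_simps)
  qed
  have "inj_on \<Psi> S"
  proof (rule inj_onI)
    fix A B assume AB: "A \<in> S" "B \<in> S" "\<Psi> A = \<Psi> B"
    have "A $$ (i, j) = B $$ (i, j)" if "i < 2" "j < 2" for i j
      using that AB(3) tr[OF AB(1)] tr[OF AB(2)] by (auto simp: \<Psi>_def less_2_cases_iff)
    then show "A = B" using AB(1,2) by (intro eq_matI) (auto simp: S_def rat_mats_char_poly_def rat_mats_def)
  qed
  moreover have "\<Psi> ` S \<subseteq> (SIGMA a:X. W a)"
  proof
    fix x assume "x \<in> \<Psi> ` S"
    then obtain A where A: "A \<in> S" "x = \<Psi> A" by blast
    have F: "A $$ (i, j) \<in> F" if "i < 2" "j < 2" for i j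
      using rat_mats_char_poly_entry[OF A(1)[unfolded S_def] that] by (simp add: F_def)
    show "x \<in> (SIGMA a:X. W a)"
      using tr[OF A(1)] F[of 0 0] F[of 0 1] F[of 1 0] F[of 1 1] by (simp add: A(2) \<Psi>_def X_def W_def)
  qed
  ultimately have "card S \<le> card (SIGMA a:X. W a)" using finX finW by (intro card_inj_on_le) auto
  also have "\<dots> = (\<Sum>a\<in>X. card (W a))" using finX finW by simp
  finally have "real (card S) \<le> (\<Sum>a\<in>X. real (card (W a)))" 
    unfolding of_nat_sum[symmetric] by (rule of_nat_mono)
  also have "\<dots> \<le> (\<Sum>a\<in>X. 6 * D\<^sup>2 * card {(e, f) \<in> N \<times> N. a * (t - a) - c \<in> farey_rats (h e f)})"
    unfolding W_def F_def N_def h_def by (intro sum_mono card_product_representations[OF H D2])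
  also have "\<dots> = 6 * D\<^sup>2 * (\<Sum>a\<in>X. \<Sum>(e, f)\<in>N \<times> N. if a * (t - a) - c \<in> farey_rats (h e f) then 1 else 0)"
  proof -
    have "real (card {(e, f) \<in> N \<times> N. Q e f}) = (\<Sum>(e, f)\<in>N \<times> N. if Q e f then 1 else 0)" for Q
    proof -
      have "(\<Sum>(e, f)\<in>N \<times> N. if Q e f then 1 else (0 :: real)) = 
          (\<Sum>p\<in>N \<times> N. if p \<in> {(e, f). Q e f} then 1 else 0)"
        by (intro sum.cong) auto
      also have "\<dots> = real (card (N \<times> N \<inter> {(e, f). Q e f}))"
        by (subst sum.inter_restrict[symmetric]) (simp_all add: N_def)
      also have "N \<times> N \<inter> {(e, f). Q e f} = {(e, f) \<in> N \<times> N. Q e f}" by auto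
      finally show ?thesis by simp
    qed
    then show ?thesis by (simp only: sum_distrib_left)
  qed
  also have "\<dots> = 6 * D\<^sup>2 * (\<Sum>(e, f)\<in>N \<times> N. \<Sum>a\<in>X. if a * (t - a) - c \<in> farey_rats (h e f) then 1 else 0)"
    by (subst sum.swap) (simp add: case_prod_unfold)
  also have "\<dots> = 6 * D\<^sup>2 * (\<Sum>(e, f)\<in>N \<times> N. real (card {a \<in> F. t - a \<in> F \<and> a * (t - a) - c \<in> farey_rats (h e f)}))"
    using finX by (simp add: sum.If_cases Int_def X_def conj_assoc)
  also have "\<dots> \<le> 6 * D\<^sup>2 * (\<Sum>(e, f)\<in>N \<times> N. 12 * D * (1 + ln H) * (H\<^sup>2 / (real e * real f)))"
  proof (intro mult_left_mono sum_mono)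
    fix ef assume "ef \<in> N \<times> N"
    then obtain e f where ef: "ef = (e, f)" "e \<in> N" "f \<in> N" by blast
    have h: "1 \<le> h e f" "h e f \<le> H\<^sup>2"
      unfolding h_def by (rule gcd_range_hyperbola[OF H ef(2,3)[unfolded N_def]])+
    have "real (card {a \<in> F. t - a \<in> F \<and> a * (t - a) - c \<in> farey_rats (h e f)}) \<le> 6 * D * (1 + ln (h e f)) * h e f"
      unfolding F_def by (rule card_quadratic_values[OF h H D])
    also have "\<dots> \<le> 12 * D * (1 + ln H) * h e f"
    proof (intro mult_right_mono)
      have "ln (h e f) \<le> ln (H\<^sup>2)" using h by (intro ln_mono) auto
      also have "\<dots> = 2 * ln H" using H by (simp add: ln_realpow)
      finally have "6 * D * (1 + ln (h e f)) \<le> 6 * D * (2 * (1 + ln H))"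
        using D1 by (intro mult_left_mono) auto
      then show "6 * D * (1 + ln (h e f)) \<le> 12 * D * (1 + ln H)" by (simp add: algebra_simps)
    qed (use h in auto)
    finally show "(case ef of (e, f) \<Rightarrow> real (card {a \<in> F. t - a \<in> F \<and> a * (t - a) - c \<in> farey_rats (h e f)})) \<le>
      (case ef of (e, f) \<Rightarrow> 12 * D * (1 + ln H) * (H\<^sup>2 / (real e * real f)))"
      by (simp add: ef h_def)
  qed simp
  also have "\<dots> = 6 * D\<^sup>2 * (12 * D * (1 + ln H) * (\<Sum>(e, f)\<in>N \<times> N. H\<^sup>2 / (real e * real f)))"
    unfolding sum_distrib_left case_prod_unfold ..
  also have "\<dots> \<le> 6 * D\<^sup>2 * (12 * D * (1 + ln H) * (H\<^sup>2 * (1 + ln H)\<^sup>2))"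
    using sum_hyperbola_le[OF H] lnH D1 by (intro mult_left_mono) (auto simp: N_def)
  also have "6 * D\<^sup>2 * (12 * D * l * (H\<^sup>2 * l\<^sup>2)) = 72 * D ^ 3 * l ^ 3 * H\<^sup>2" for l :: real
    by (simp add: power2_eq_square power3_eq_cube)
  finally show ?thesis by (simp only: S_def)
qed

theorem theorem2p3:
  fixes n :: nat
  assumes "n \<ge> 2"
  shows "\<exists>C>0. \<forall>\<epsilon>>0. \<exists>H0\<ge>1. \<forall>H\<ge>H0. \<forall>f :: rat poly.
    real (card (rat_mats_char_poly n H f))
      \<le> C * H powr ((if n = 2 then 2 else real (n ^ 2)) + \<epsilon>)"
proof (rule exI[of _ 1], intro conjI allI impI)
  \<comment> \<open>\<open>C = 1\<close> works since \<open>H powr \<epsilon>\<close> absorbs all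
    constants. \<open>H0\<close> is obtained before \<open>f\<close> is fixed, which gives
    uniformity.\<close>
  fix \<epsilon> :: real assume \<epsilon>: "\<epsilon> > 0"
  show "\<exists>H0\<ge>1. \<forall>H\<ge>H0. \<forall>f :: rat poly. real (card (rat_mats_char_poly n H f))
      \<le> 1 * H powr ((if n = 2 then 2 else real (n ^ 2)) + \<epsilon>)"
  proof (cases "n = 2")
    case True
    obtain H0 where H0: "H0 \<ge> 1" "\<And>H. H \<ge> H0 \<Longrightarrow> \<exists>D. divisor_bound (H ^ 8) D \<and>
      72 * D ^ 3 * (1 + ln H) ^ 3 * H\<^sup>2 \<le> H powr (real 2 + \<epsilon>)"
      using divisor_bound_powr_absorb[of 72 \<epsilon> 8 3 3 2] \<epsilon> by auto
    show ?thesis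
    proof (rule exI[of _ H0], intro conjI allI impI)
      fix H :: real and f :: "rat poly" assume H: "H \<ge> H0"
      then obtain D where D: "divisor_bound (H ^ 8) D" "72 * D ^ 3 * (1 + ln H) ^ 3 * H\<^sup>2 \<le> H powr (real 2 + \<epsilon>)"
        using H0(2) by blast
      have "real (card (rat_mats_char_poly 2 H f)) \<le> 72 * D ^ 3 * (1 + ln H) ^ 3 * H\<^sup>2"
        using H H0(1) by (intro card_rat_mats_char_poly_2_le D(1)) simp
      then show "real (card (rat_mats_char_poly n H f)) \<le> 1 * H powr ((if n = 2 then 2 else real (n ^ 2)) + \<epsilon>)"
        using D(2) True by simp
    qed (rule H0(1))
  next
    case False
    define m where "m = (\<Sum>j<n. j)"
    have m: "n + 2 * m = n\<^sup>2" using double_sum_lessThan[of n] by (simp add: m_def)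
    obtain H0 where H0: "H0 \<ge> 1" "\<And>H. H \<ge> H0 \<Longrightarrow> \<exists>D. divisor_bound (H ^ (n\<^sup>2 + 8)) D \<and>
      3 ^ n * 36 ^ m * D ^ (2 * n + 4 * m) * (1 + ln H) ^ (n + 3 * m) * H ^ (n\<^sup>2) \<le> H powr (real (n\<^sup>2) + \<epsilon>)"
      using divisor_bound_powr_absorb[of "3 ^ n * 36 ^ m" \<epsilon> "n\<^sup>2 + 8" "2 * n + 4 * m" "n + 3 * m" "n\<^sup>2"] \<epsilon> by auto
    show ?thesis
    proof (rule exI[of _ H0], intro conjI allI impI)
      fix H :: real and f :: "rat poly" assume H: "H \<ge> H0"
      then obtain D where D: "divisor_bound (H ^ (n\<^sup>2 + 8)) D" 
        "3 ^ n * 36 ^ m * D ^ (2 * n + 4 * m) * (1 + ln H) ^ (n + 3 * m) * H ^ (n\<^sup>2) \<le> H powr (real (n\<^sup>2) + \<epsilon>)"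
        using H0(2) by blast
      have "real (card (rat_mats_char_poly n H f)) \<le>
          (3 * D\<^sup>2 * (1 + ln H) * H) ^ n * (36 * D ^ 4 * (1 + ln H) ^ 3 * H\<^sup>2) ^ m"
        unfolding m_def using H H0(1) by (intro card_rat_mats_char_poly_le D(1)) simp
      \<comment> \<open>Each diagonal entry contributes one power of \<open>H\<close> and each pair
        of opposite entries two, in total \<open>n + 2 * m = n\<^sup>2\<close>.\<close>
      also have "\<dots> = 3 ^ n * 36 ^ m * D ^ (2 * n + 4 * m) * (1 + ln H) ^ (n + 3 * m) * H ^ (n\<^sup>2)"
        unfolding m[symmetric] by (simp add: power_mult_distrib power_add mult_ac flip: power_mult)
      finally show "real (card (rat_mats_char_poly n H f)) \<le> 1 * H powr ((if n = 2 then 2 else real (n ^ 2)) + \<epsilon>)"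
        using D(2) False by simp
    qed (rule H0(1))
  qed
qed simp

end
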